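(* Assume that $\big(\bar E^{(N)}(0),\bar F^{(N)}(0)\big)\Rightarrow(e(0),f(0))\in\mathcal{T}$ (weak convergence) as $N\to\infty$. Then there exists a unique solution $(e,f):\mathbb{R}_+\to\mathcal{T}$ and $u:\mathbb{R}_+\to\mathbb{R}_+^r$ (càdlàg functions, with $(e,f)$ having initial value $(e(0),f(0))$) to the dynamical system, for $t\ge0$, $$f_{ij}(t)=f_{ij}(0)+\lambda_iP_{ij}\big(t-u_i(t)\big)-\mu_{ij}\int_0^tf_{ij}(s)\,ds,\quad 1\le i,j\le r,$$ $$e_{ij}(t)=e_{ij}(0)-\mu_{ij}\int_0^te_{ij}(s)\,ds+Q_{ij}\sum_{k=1}^r\mu_{ki}\int_0^tf_{ki}(s)\,ds,\quad 1\le i\ne j\le r,$$ $$e_{ii}(t)=e_{ii}(0)-\lambda_i\big(t-u_i(t)\big)+\sum_{j\ne i}\mu_{ji}\int_0^te_{ji}(s)\,ds+Q_{ii}\sum_{j=1}^r\mu_{ji}\int_0^tf_{ji}(s)\,ds,\quad 1\le i\le r,$$ $$u \text{ is non-decreasing (componentwise) with } u(0)=0,\ \text{ and }\ \int_0^\infty e_{ii}(s)\,du_i(s)=0\ \text{ for all } 1\le i\le r.$$ Furthermore, for all $T\ge0$, $$\lim_{N\to\infty}\big\|\big(\bar E^{(N)},\bar F^{(N)},I^{(N)}\big)-(e,f,u)\big\|_T=0$$ almost surely.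
   Context: Fix an integer $r\ge1$, reals $\lambda_i>0$, $\mu_{ij}>0$ ($1\le i,j\le r$), and $r\times r$ row-stochastic matrices $P=(P_{ij})$ and $Q=(Q_{ij})$. Let $$\mathcal{T}=\Big\{(e,f)\in[0,1]^{r\times r}\times[0,1]^{r\times r}:\ \sum_{i,j}(e_{ij}+f_{ij})=1\Big\}.$$ For $x$ a càdlàg function on $[0,\infty)$ with values in $\mathbb{R}^n$, $\|x\|_T=\max_{1\le i\le n}\sup_{0\le t\le T}|x_i(t)|$. All processes are built on one probability space from the same primitives for all $N$: mutually independent unit-rate Poisson processes $S^E_{ij}$, $S^F_{ij}$ ($1\le i,j\le r$), and independent i.i.d. routing sequences $(\phi_i(m))_{m\ge1}$ with $\mathbb{P}(\phi_i(m)=j)=P_{ij}$ and $(\psi_{ij}(m))_{m\ge1}$ with $\mathbb{P}(\psi_{ij}(m)=k)=Q_{jk}$. For each positive integer $N$, given an initial state $(E^{(N)}(0),F^{(N)}(0))\in\mathbb{Z}_+^{r\times r}\times\mathbb{Z}_+^{r\times r}$ with total sum $N$, the process $(E^{(N)},F^{(N)})$ (a continuous-time Markov chain) is the unique solution of $$F^{(N)}_{ij}(t)=F^{(N)}_{ij}(0)-S^F_{ij}\Big(\mu_{ij}\int_0^tF^{(N)}_{ij}(s)\,ds\Big)+\#\big\{m\le S^E_{ii}(N\lambda_iT^{(N)}_i(t)):\phi_i(m)=j\big\},\quad 1\le i,j\le r,$$ $$E^{(N)}_{ij}(t)=E^{(N)}_{ij}(0)-S^E_{ij}\Big(\mu_{ij}\int_0^tE^{(N)}_{ij}(s)\,ds\Big)+\sum_{k=1}^r\#\Big\{m\le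 S^F_{ki}\Big(\mu_{ki}\int_0^tF^{(N)}_{ki}(s)\,ds\Big):\psi_{ki}(m)=j\Big\},\quad i\ne j,$$ $$E^{(N)}_{ii}(t)=E^{(N)}_{ii}(0)-S^E_{ii}(N\lambda_iT^{(N)}_i(t))+\sum_{j\ne i}S^E_{ji}\Big(\mu_{ji}\int_0^tE^{(N)}_{ji}(s)\,ds\Big)+\sum_{j=1}^r\#\Big\{m\le S^F_{ji}\Big(\mu_{ji}\int_0^tF^{(N)}_{ji}(s)\,ds\Big):\psi_{ji}(m)=i\Big\},\quad 1\le i\le r,$$ where $T^{(N)}_i(t)=\int_0^t1(E^{(N)}_{ii}(s)>0)\,ds$. Set $\bar E^{(N)}=E^{(N)}/N$, $\bar F^{(N)}=F^{(N)}/N$ and $I^{(N)}_i(t)=\int_0^t1(E^{(N)}_{ii}(s)=0)\,ds$, $I^{(N)}=(I^{(N)}_1,\dots,I^{(N)}_r)$.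
   Formalization: Initial states are taken deterministic, so weak convergence means ordinary convergence; for random ones converging only weakly the a.s. claim fails already at T=0. Random initial states independent of the primitives and converging a.s. follow by conditioning on them. *)

theory Defs
  imports "HOL-Probability.Probability"
begin

(* Square arrays are values of type real^'r^'r; the finite index type 'r plays the role of
   {1..r}, and types are nonempty, so r >= 1. Paths are functions on real of which
   only the restriction to [0, oo) matters. *)

definition row_stochastic :: "real^'r::finite^'r \<Rightarrow> bool" where
  "row_stochastic A \<longleftrightarrow> (\<forall>i j. 0 \<le> A $ i $ j) \<and> (\<forall>i. (\<Sum>j\<in>UNIV. A $ i $ j) = 1)"

definition fluid_states :: "((real^'r::finite^'r) \<times> (real^'r^'r)) set" where
  "fluid_states = {(e, f). (\<forall>i j. e $ i $ j \<in> {0..1} \<and> f $ i $ j \<in> {0..1}) \<and>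
     (\<Sum>i\<in>UNIV. \<Sum>j\<in>UNIV. e $ i $ j + f $ i $ j) = 1}"

definition cadlag :: "(real \<Rightarrow> 'a::topological_space) \<Rightarrow> bool" where
  "cadlag x \<longleftrightarrow> (\<forall>t\<ge>0. (x \<longlongrightarrow> x t) (at_right t)) \<and> (\<forall>t>0. \<exists>l. (x \<longlongrightarrow> l) (at_left t))"

(* Basis is the standard coordinate basis, so the inner products range over the
   coordinates of x t. *)
definition sup_norm_upto :: "real \<Rightarrow> (real \<Rightarrow> 'a::euclidean_space) \<Rightarrow> real" where
  "sup_norm_upto T x = Max ((\<lambda>b. SUP t\<in>{0..T}. \<bar>x t \<bullet> b\<bar>) ` Basis)"

(* weak_conv_m of the library is restricted to measures on the reals. *)
definition weakly_converges :: "(nat \<Rightarrow> 'a::topological_space measure) \<Rightarrow> 'a measure \<Rightarrow> bool" where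
  "weakly_converges \<nu>s \<nu> \<longleftrightarrow>
     (\<forall>g :: 'a \<Rightarrow> real. continuous_on UNIV g \<and> bounded (range g) \<longrightarrow>
        (\<lambda>n. \<integral>x. g x \<partial>\<nu>s n) \<longlonglongrightarrow> (\<integral>x. g x \<partial>\<nu>))"

definition unit_poisson_process :: "'w measure \<Rightarrow> (real \<Rightarrow> 'w \<Rightarrow> nat) \<Rightarrow> bool" where
  "unit_poisson_process M S \<longleftrightarrow>
     (\<forall>t\<ge>0. S t \<in> measurable M (count_space UNIV)) \<and>
     (\<forall>\<omega>\<in>space M. S 0 \<omega> = 0 \<and> mono_on {0..} (\<lambda>t. S t \<omega>) \<and> cadlag (\<lambda>t. real (S t \<omega>))) \<and>
     (\<forall>s t. 0 \<le> s \<and> s < t \<longrightarrow>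
        distr M (count_space UNIV) (\<lambda>\<omega>. S t \<omega> - S s \<omega>) = measure_pmf (poisson_pmf (t - s))) \<and>
     (\<forall>(\<tau> :: nat \<Rightarrow> real) n. 0 \<le> \<tau> 0 \<and> (\<forall>k<n. \<tau> k \<le> \<tau> (Suc k)) \<longrightarrow>
        prob_space.indep_vars M (\<lambda>_. count_space UNIV)
          (\<lambda>k \<omega>. S (\<tau> (Suc k)) \<omega> - S (\<tau> k) \<omega>) {..<n})"

definition iid_sequence :: "'w measure \<Rightarrow> ('r::finite \<Rightarrow> real) \<Rightarrow> (nat \<Rightarrow> 'w \<Rightarrow> 'r) \<Rightarrow> bool" where
  "iid_sequence M p X \<longleftrightarrow>
     prob_space.indep_vars M (\<lambda>_. count_space UNIV) X {1..} \<and>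
     (\<forall>m\<ge>1. \<forall>j. measure M {\<omega> \<in> space M. X m \<omega> = j} = p j)"

(* The sigma-algebra generated by a family of random variables with countable discrete values. *)
definition generated_events :: "'w measure \<Rightarrow> 't set \<Rightarrow> ('t \<Rightarrow> 'w \<Rightarrow> 'b) \<Rightarrow> 'w set set" where
  "generated_events M I X = sigma_sets (space M) {X t -` A \<inter> space M | t A. t \<in> I}"

datatype 'r primitive = Prim_SE 'r 'r | Prim_SF 'r 'r | Prim_Phi 'r | Prim_Psi 'r 'r

locale network_primitives = prob_space M
  for M :: "'w measure" +
  fixes P Q :: "real^'r::finite^'r"
    and SE SF :: "'r \<Rightarrow> 'r \<Rightarrow> real \<Rightarrow> 'w \<Rightarrow> nat"
    and \<phi> :: "'r \<Rightarrow> nat \<Rightarrow> 'w \<Rightarrow> 'r"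
    and \<psi> :: "'r \<Rightarrow> 'r \<Rightarrow> nat \<Rightarrow> 'w \<Rightarrow> 'r"
  assumes SE_poisson: "unit_poisson_process M (SE i j)"
    and SF_poisson: "unit_poisson_process M (SF i j)"
    and \<phi>_iid: "iid_sequence M (\<lambda>j. P $ i $ j) (\<phi> i)"
    and \<psi>_iid: "iid_sequence M (\<lambda>k. Q $ j $ k) (\<psi> i j)"
    and primitives_indep:
      "indep_sets
         (\<lambda>c. case c of
             Prim_SE i j \<Rightarrow> generated_events M {0..} (SE i j)
           | Prim_SF i j \<Rightarrow> generated_events M {0..} (SF i j)
           | Prim_Phi i \<Rightarrow> generated_events M {1..} (\<phi> i)
           | Prim_Psi i j \<Rightarrow> generated_events M {1..} (\<psi> i j)) UNIV"

definition routed :: "(nat \<Rightarrow> 'r) \<Rightarrow> 'r \<Rightarrow> nat \<Rightarrow> nat" where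
  "routed route j n = card {m \<in> {1..n}. route m = j}"

definition busy_time :: "(real \<Rightarrow> real^'r::finite^'r) \<Rightarrow> 'r \<Rightarrow> real \<Rightarrow> real" where
  "busy_time E i t = integral {0..t} (\<lambda>s. if E s $ i $ i > 0 then 1 else 0)"

definition idle_time :: "(real \<Rightarrow> real^'r::finite^'r) \<Rightarrow> real \<Rightarrow> real^'r" where
  "idle_time E t = (\<chi> i. integral {0..t} (\<lambda>s. if E s $ i $ i = 0 then 1 else 0))"

definition initial_state :: "nat \<Rightarrow> real^'r::finite^'r \<Rightarrow> real^'r^'r \<Rightarrow> bool" where
  "initial_state N E0 F0 \<longleftrightarrow>
     (\<forall>i j. E0 $ i $ j \<in> \<nat> \<and> F0 $ i $ j \<in> \<nat>) \<and>
     (\<Sum>i\<in>UNIV. \<Sum>j\<in>UNIV. E0 $ i $ j + F0 $ i $ j) = real N"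

(* The equations for one realisation of the primitives: SE, SF, phi, psi are sample paths here. *)
definition network_path ::
  "real^'r::finite \<Rightarrow> real^'r^'r \<Rightarrow> nat \<Rightarrow>
   ('r \<Rightarrow> 'r \<Rightarrow> real \<Rightarrow> nat) \<Rightarrow> ('r \<Rightarrow> 'r \<Rightarrow> real \<Rightarrow> nat) \<Rightarrow> ('r \<Rightarrow> nat \<Rightarrow> 'r) \<Rightarrow> ('r \<Rightarrow> 'r \<Rightarrow> nat \<Rightarrow> 'r) \<Rightarrow>
   real^'r^'r \<Rightarrow> real^'r^'r \<Rightarrow> (real \<Rightarrow> real^'r^'r) \<Rightarrow> (real \<Rightarrow> real^'r^'r) \<Rightarrow> bool" where
  "network_path lam \<mu> N SE SF \<phi> \<psi> E0 F0 E F \<longleftrightarrow>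
     cadlag (\<lambda>t. (E t, F t)) \<and>
     (\<forall>t\<ge>0. \<forall>i j. E t $ i $ j \<in> \<nat> \<and> F t $ i $ j \<in> \<nat>) \<and>
     (\<forall>t\<ge>0. \<forall>i j. F t $ i $ j =
        F0 $ i $ j
        - real (SF i j (\<mu> $ i $ j * integral {0..t} (\<lambda>s. F s $ i $ j)))
        + real (routed (\<phi> i) j (SE i i (real N * lam $ i * busy_time E i t)))) \<and>
     (\<forall>t\<ge>0. \<forall>i j. i \<noteq> j \<longrightarrow> E t $ i $ j =
        E0 $ i $ j
        - real (SE i j (\<mu> $ i $ j * integral {0..t} (\<lambda>s. E s $ i $ j)))
        + (\<Sum>k\<in>UNIV. real (routed (\<psi> k i) j
             (SF k i (\<mu> $ k $ i * integral {0..t} (\<lambda>s. F s $ k $ i)))))) \<and>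
     (\<forall>t\<ge>0. \<forall>i. E t $ i $ i =
        E0 $ i $ i
        - real (SE i i (real N * lam $ i * busy_time E i t))
        + (\<Sum>j\<in>UNIV - {i}. real (SE j i (\<mu> $ j $ i * integral {0..t} (\<lambda>s. E s $ j $ i))))
        + (\<Sum>j\<in>UNIV. real (routed (\<psi> j i) i
             (SF j i (\<mu> $ j $ i * integral {0..t} (\<lambda>s. F s $ j $ i))))))"

(* In the last conjunct, u is frozen at u 0 on the negative half-line, so that
   interval_measure is the Lebesgue-Stieltjes measure of u on (0, oo), with no atom at 0
   (u 0 = 0). The integrand is nonnegative by the second conjunct, so that ennreal
   does not truncate it. *)
definition fluid_solution ::
  "real^'r::finite \<Rightarrow> real^'r^'r \<Rightarrow> real^'r^'r \<Rightarrow> real^'r^'r \<Rightarrow> real^'r^'r \<Rightarrow> real^'r^'r \<Rightarrow>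
   (real \<Rightarrow> real^'r^'r) \<Rightarrow> (real \<Rightarrow> real^'r^'r) \<Rightarrow> (real \<Rightarrow> real^'r) \<Rightarrow> bool" where
  "fluid_solution lam \<mu> P Q e0 f0 e f u \<longleftrightarrow>
     cadlag (\<lambda>t. (e t, f t, u t)) \<and>
     (\<forall>t\<ge>0. (e t, f t) \<in> fluid_states) \<and>
     (\<forall>t\<ge>0. \<forall>i. 0 \<le> u t $ i) \<and>
     e 0 = e0 \<and> f 0 = f0 \<and>
     (\<forall>t\<ge>0. \<forall>i j. f t $ i $ j =
        f 0 $ i $ j + lam $ i * P $ i $ j * (t - u t $ i)
        - \<mu> $ i $ j * integral {0..t} (\<lambda>s. f s $ i $ j)) \<and>
     (\<forall>t\<ge>0. \<forall>i j. i \<noteq> j \<longrightarrow> e t $ i $ j =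
        e 0 $ i $ j - \<mu> $ i $ j * integral {0..t} (\<lambda>s. e s $ i $ j)
        + Q $ i $ j * (\<Sum>k\<in>UNIV. \<mu> $ k $ i * integral {0..t} (\<lambda>s. f s $ k $ i))) \<and>
     (\<forall>t\<ge>0. \<forall>i. e t $ i $ i =
        e 0 $ i $ i - lam $ i * (t - u t $ i)
        + (\<Sum>j\<in>UNIV - {i}. \<mu> $ j $ i * integral {0..t} (\<lambda>s. e s $ j $ i))
        + Q $ i $ i * (\<Sum>j\<in>UNIV. \<mu> $ j $ i * integral {0..t} (\<lambda>s. f s $ j $ i))) \<and>
     u 0 = 0 \<and> (\<forall>i. mono_on {0..} (\<lambda>t. u t $ i)) \<and>
     (\<forall>i. (\<integral>\<^sup>+s\<in>{0..}. ennreal (e s $ i $ i) \<partial>interval_measure (\<lambda>s. u (max 0 s) $ i)) = 0)"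

end

theory Submission
  imports Defs
begin

text \<open>Pathwise, the scaled network solves the fluid equations up to an error which vanishes by the laws of
  large numbers for the primitives. Both the idle time and the process \<open>u\<close> act as a one-dimensional
  reflection: they increase only while \<open>e\<^sub>i\<^sub>i = 0\<close>. Since the reflection term depends on the free
  process in a Lipschitz way for the running supremum, a Gronwall argument shows that two approximate
  solutions on \<open>[0, T]\<close> differ by at most a constant times the sum of their errors. This one estimate
  gives uniqueness, the Cauchy property of the scaled paths of a single good realisation (whose limit is
  the fluid solution, so that no fixed-point construction is needed), and almost sure convergence.\<close>

section \<open>Laws of large numbers for the primitives\<close>

text \<open>The obstacle is the indicator inside \<open>busy_time\<close> and
  \<open>idle_time\<close>: it is discontinuous in the state, so idle times do not converge as
  functionals of the state, and Stieltjes integrals against them do not pass to the limit directly.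
  Complementarity is therefore handled in two measure-free forms: a zero of the diagonal entry
  exists at a level of \<open>u\<close> just below \<open>u t\<close> (for comparing two solutions),
  and \<open>u\<close> is constant on intervals without zeros (for constructing the limit). Two
  lemmas link these forms to the Stieltjes integral. The laws of large numbers enter as linear
  bounds with small slope, \<open>|g s| <= eps * h s + C\<close> for all \<open>s\<close> at once,
  where \<open>C\<close> may depend on the realisation and on \<open>eps\<close>. With
  \<open>h s = s\<close>, dividing by \<open>N\<close> on \<open>[0, N K]\<close> leaves at most
  \<open>eps * K + C / N\<close>. This is uniform in the argument, hence insensitive to the random
  time changes: the scaled states lie in \<open>[0, 1]\<close>, which keeps every clock reading up
  to time \<open>T\<close> below \<open>N K\<close>.\<close>

definition sublinear_on :: "'a set \<Rightarrow> ('a \<Rightarrow> real) \<Rightarrow> ('a \<Rightarrow> real) \<Rightarrow> bool" where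
  "sublinear_on A h g \<longleftrightarrow> (\<forall>\<epsilon>>0. \<exists>C. \<forall>s\<in>A. \<bar>g s\<bar> \<le> \<epsilon> * h s + C)"

lemma sublinear_onI:
  "(\<And>\<epsilon>. \<epsilon> > 0 \<Longrightarrow> \<exists>C. \<forall>s\<in>A. \<bar>g s\<bar> \<le> \<epsilon> * h s + C) \<Longrightarrow> sublinear_on A h g"
  by (simp add: sublinear_on_def)

lemma sublinear_onE:
  assumes "sublinear_on A h g" "\<epsilon> > 0"
  obtains C where "C \<ge> 0" "\<And>s. s \<in> A \<Longrightarrow> \<bar>g s\<bar> \<le> \<epsilon> * h s + C"
proof -
  obtain C where C: "\<And>s. s \<in> A \<Longrightarrow> \<bar>g s\<bar> \<le> \<epsilon> * h s + C"
    using assms unfolding sublinear_on_def by meson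
  have "\<bar>g s\<bar> \<le> \<epsilon> * h s + max 0 C" if "s \<in> A" for s
    using C[OF that] by linarith
  then show thesis using that[of "max 0 C"] by auto
qed

text \<open>Borel-Cantelli at each level \<open>1 / Suc m\<close>, then a countable intersection
  over \<open>m\<close>. For a given \<epsilon> all but finitely many indices obey the bound without
  a constant; the finitely many others are absorbed in \<open>C\<close>, here the sum of their
  absolute values.\<close>

lemma (in prob_space) AE_sublinear_of_summable_tails:
  fixes X :: "nat \<Rightarrow> 'a \<Rightarrow> real"
  assumes X[measurable]: "\<And>k. random_variable borel (X k)"
    and tails: "\<And>\<epsilon>. \<epsilon> > 0 \<Longrightarrow> summable (\<lambda>k. prob {\<omega>\<in>space M. \<bar>X k \<omega>\<bar> \<ge> \<epsilon> * h k})"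
    and h: "\<And>k. h k \<ge> 0"
  shows "AE \<omega> in M. sublinear_on UNIV h (\<lambda>k. X k \<omega>)"
proof -
  have "AE \<omega> in M. eventually (\<lambda>k. \<omega> \<in> space M - {\<omega>\<in>space M. \<bar>X k \<omega>\<bar> \<ge> 1 / Suc m * h k}) sequentially" for m
    using tails[of "1 / Suc m"] by (intro borel_cantelli_AE1) (auto simp: emeasure_eq_measure)
  then have "AE \<omega> in M. \<forall>m. eventually (\<lambda>k. \<omega> \<in> space M - {\<omega>\<in>space M. \<bar>X k \<omega>\<bar> \<ge> 1 / Suc m * h k}) sequentially"
    by (simp add: AE_all_countable)
  then show ?thesis
  proof eventually_elim
    fix \<omega> assume *: "\<forall>m. eventually (\<lambda>k. \<omega> \<in> space M - {\<omega>\<in>space M. \<bar>X k \<omega>\<bar> \<ge> 1 / Suc m * h k}) sequentially"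
    show "sublinear_on UNIV h (\<lambda>k. X k \<omega>)"
    proof (rule sublinear_onI)
      fix \<epsilon> :: real assume "\<epsilon> > 0"
      then obtain m where m: "1 / Suc m < \<epsilon>"
        using nat_approx_posE by blast
      obtain n where n: "\<And>k. k \<ge> n \<Longrightarrow> \<omega> \<in> space M - {\<omega>\<in>space M. \<bar>X k \<omega>\<bar> \<ge> 1 / Suc m * h k}"
        using *[rule_format, of m] by (auto simp: eventually_sequentially)
      have "\<bar>X k \<omega>\<bar> \<le> \<epsilon> * h k + (\<Sum>i<n. \<bar>X i \<omega>\<bar>)" for k
      proof (cases "k \<ge> n")
        case True
        have "\<bar>X k \<omega>\<bar> \<le> 1 / Suc m * h k" using n[OF True] by auto
        also have "\<dots> \<le> \<epsilon> * h k" using m h by (intro mult_right_mono) auto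
        also have "\<dots> \<le> \<epsilon> * h k + (\<Sum>i<n. \<bar>X i \<omega>\<bar>)" by (simp add: sum_nonneg)
        finally show ?thesis .
      next
        case False
        then have "\<bar>X k \<omega>\<bar> \<le> (\<Sum>i<n. \<bar>X i \<omega>\<bar>)"
          by (intro member_le_sum) auto
        then show ?thesis using \<open>\<epsilon> > 0\<close> h[of k] by (simp add: add_increasing)
      qed
      then show "\<exists>C. \<forall>k\<in>UNIV. \<bar>X k \<omega>\<bar> \<le> \<epsilon> * h k + C" by blast
    qed
  qed
qed

text \<open>Everything rests on the recursion \<open>Suc k * p (Suc k) = r * p k\<close>: an index
  shift reduces the series of the first moment to the total mass, and that of the second moment to
  the first moment and the total mass.\<close>

lemma poisson_pmf_moments:
  assumes "r > 0"
  shows "integrable (measure_pmf (poisson_pmf r)) real"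
    and "measure_pmf.expectation (poisson_pmf r) real = r"
    and "integrable (measure_pmf (poisson_pmf r)) (\<lambda>k. (real k)\<^sup>2)"
    and "measure_pmf.expectation (poisson_pmf r) (\<lambda>k. (real k)\<^sup>2) = r\<^sup>2 + r"
proof -
  define p where "p k = r ^ k / fact k * exp (- r)" for k :: nat
  have p: "pmf (poisson_pmf r) k = p k" for k
    using assms by (simp add: p_def)
  have p_nonneg: "p k \<ge> 0" for k using assms by (simp add: p_def)
  have "(\<lambda>k. r ^ k /\<^sub>R fact k) sums exp r" by (rule exp_converges)
  then have "(\<lambda>k. r ^ k /\<^sub>R fact k * exp (- r)) sums (exp r * exp (- r))" by (rule sums_mult2)
  then have p0: "p sums 1" by (simp add: p_def[abs_def] exp_minus field_simps)
  have step: "real (Suc k) * p (Suc k) = r * p k" for k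
    by (simp add: p_def divide_simps del: of_nat_Suc)
  have "(\<lambda>k. real (Suc k) * p (Suc k)) sums (r * 1)"
    unfolding step by (intro sums_mult p0)
  then have p1: "(\<lambda>k. real k * p k) sums r"
    using sums_Suc_iff[of "\<lambda>k. real k * p k" r] by simp
  have "(\<lambda>k. r * (real k * p k) + r * p k) sums (r * r + r * 1)"
    by (intro sums_add sums_mult p0 p1)
  moreover have "r * (real k * p k) + r * p k = (real (Suc k))\<^sup>2 * p (Suc k)" for k
  proof -
    have "(real (Suc k))\<^sup>2 * p (Suc k) = real (Suc k) * (real (Suc k) * p (Suc k))"
      by (simp add: power2_eq_square del: of_nat_Suc)
    also have "\<dots> = real (Suc k) * (r * p k)" by (simp only: step)
    finally show ?thesis by (simp add: algebra_simps)
  qed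
  ultimately have "(\<lambda>k. (real (Suc k))\<^sup>2 * p (Suc k)) sums (r\<^sup>2 + r)"
    by (simp add: power2_eq_square)
  then have p2: "(\<lambda>k. (real k)\<^sup>2 * p k) sums (r\<^sup>2 + r)"
    using sums_Suc_iff[of "\<lambda>k. (real k)\<^sup>2 * p k" "r\<^sup>2 + r"] by simp
  \<comment> \<open>Nonnegative terms make the series absolutely summable, so its sum is the
    integral against the density \<open>p\<close> of the counting measure.\<close>
  have *: "has_bochner_integral (measure_pmf (poisson_pmf r)) g s"
    if s: "(\<lambda>k. g k * p k) sums s" and g: "\<And>k. g k \<ge> 0" for g :: "nat \<Rightarrow> real" and s
  proof -
    have int: "integrable (count_space UNIV) (\<lambda>k. p k *\<^sub>R g k)"
      using s g p_nonneg by (auto simp: integrable_count_space_nat_iff sums_iff mult.commute)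
    have "(\<lambda>k. p k *\<^sub>R g k) sums (\<integral>k. p k *\<^sub>R g k \<partial>count_space UNIV)"
      by (rule sums_integral_count_space_nat[OF int])
    then have "(\<integral>k. p k *\<^sub>R g k \<partial>count_space UNIV) = s"
      using s by (simp add: mult.commute sums_iff)
    then show ?thesis
      unfolding measure_pmf_eq_density using int p_nonneg
      by (simp add: has_bochner_integral_iff integrable_density integral_density p)
  qed
  show "integrable (measure_pmf (poisson_pmf r)) real"
    "measure_pmf.expectation (poisson_pmf r) real = r"
    using *[OF p1] by (auto simp: has_bochner_integral_iff)
  show "integrable (measure_pmf (poisson_pmf r)) (\<lambda>k. (real k)\<^sup>2)"
    "measure_pmf.expectation (poisson_pmf r) (\<lambda>k. (real k)\<^sup>2) = r\<^sup>2 + r"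
    using *[OF p2] by (auto simp: has_bochner_integral_iff)
qed

lemma poisson_pmf_tail:
  assumes "r > 0" "a > 0"
  shows "measure (measure_pmf (poisson_pmf r)) {k. \<bar>real k - r\<bar> \<ge> a} \<le> r / a\<^sup>2"
proof -
  note m = poisson_pmf_moments[OF assms(1)]
  have "measure_pmf.variance (poisson_pmf r) real = r"
    by (subst measure_pmf.variance_eq) (use m in simp_all)
  then show ?thesis
    using measure_pmf.Chebyshev_inequality[where f = real, OF _ m(3) assms(2)] m(2) by simp
qed

text \<open>Squares \<open>k\<^sup>2\<close> are sparse enough for variances growing linearly to be summable, and dense enough
  for monotone interpolation.\<close>

lemma sublinear_of_squares:
  fixes S :: "real \<Rightarrow> real"
  assumes mono: "mono_on {0..} S"
    and sq: "sublinear_on UNIV (\<lambda>k. (real k)\<^sup>2) (\<lambda>k. S ((real k)\<^sup>2) - (real k)\<^sup>2)"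
  shows "sublinear_on {0..} (\<lambda>s. s) (\<lambda>s. S s - s)"
proof (rule sublinear_onI)
  fix \<epsilon> :: real assume "\<epsilon> > 0"
  \<comment> \<open>The cap 1 gives \<eta> * \<eta> \<le> \<eta>. The upper estimate below then
    costs 3 * \<eta> per unit of \<open>s\<close>, the lower one 2 * \<eta>.\<close>
  define \<eta> where "\<eta> = min 1 (\<epsilon> / 4)"
  have \<eta>: "\<eta> > 0" "\<eta> \<le> 1" "4 * \<eta> \<le> \<epsilon>" using \<open>\<epsilon> > 0\<close> by (auto simp: \<eta>_def)
  obtain C where C: "C \<ge> 0" "\<And>k. \<bar>S ((real k)\<^sup>2) - (real k)\<^sup>2\<bar> \<le> \<eta> * (real k)\<^sup>2 + C"
    using sublinear_onE[OF sq \<eta>(1)] by auto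
  have "\<bar>S s - s\<bar> \<le> \<epsilon> * s + (C + 2 * (1 / \<eta> + 1))" if "s \<ge> 0" for s
  proof -
    define k where "k = nat \<lfloor>sqrt s\<rfloor>"
    have k: "real k \<le> sqrt s" "sqrt s \<le> real k + 1"
      using that by (auto simp: k_def)
    have ks: "(real k)\<^sup>2 \<le> s" using power_mono[OF k(1), of 2] that by simp
    have sk: "s \<le> (real (Suc k))\<^sup>2" using power_mono[OF k(2), of 2] that by (simp add: add.commute)
    \<comment> \<open>An arithmetic-geometric mean inequality: the gap \<open>2 * k + 1\<close> to
      the next square is at most \<eta> * \<open>s\<close> plus a constant.\<close>
    have "0 \<le> (\<eta> * real k - 1)\<^sup>2" by simp
    then have "2 * real k * \<eta> \<le> \<eta> * (\<eta> * (real k)\<^sup>2) + 1"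
      by (simp add: power2_eq_square algebra_simps)
    then have "2 * real k \<le> \<eta> * (real k)\<^sup>2 + 1 / \<eta>" using \<eta>(1) by (simp add: field_simps)
    moreover have "\<eta> * (real k)\<^sup>2 \<le> \<eta> * s" using ks \<eta> by (intro mult_left_mono) auto
    moreover have "0 \<le> \<eta> * s" "0 < 1 / \<eta>" using \<eta> that by auto
    ultimately have gap: "2 * real k + 1 \<le> \<eta> * s + (1 / \<eta> + 1)" by linarith
    have sq_Suc: "(real (Suc k))\<^sup>2 = (real k)\<^sup>2 + (2 * real k + 1)"
      by (simp add: power2_eq_square algebra_simps)
    have "S s \<le> S ((real (Suc k))\<^sup>2)"
      using that sk by (intro mono_onD[OF mono]) auto
    also have "\<dots> \<le> (1 + \<eta>) * (real (Suc k))\<^sup>2 + C"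
      using C(2)[of "Suc k"] by (simp add: algebra_simps del: of_nat_Suc)
    also have "\<dots> \<le> (1 + \<eta>) * (s + (\<eta> * s + (1 / \<eta> + 1))) + C"
      using sq_Suc gap ks \<eta> by (intro add_right_mono mult_left_mono) auto
    also have "\<dots> = s + 2 * \<eta> * s + \<eta> * (\<eta> * s) + (1 + \<eta>) * (1 / \<eta> + 1) + C"
      by (simp add: algebra_simps)
    also have "\<dots> \<le> s + 2 * \<eta> * s + 1 * (\<eta> * s) + 2 * (1 / \<eta> + 1) + C"
      using \<eta> that by (intro add_mono mult_right_mono order_refl) auto
    also have "\<dots> \<le> s + \<epsilon> * s + (C + 2 * (1 / \<eta> + 1))"
      using mult_right_mono[OF \<eta>(3) that] \<open>0 \<le> \<eta> * s\<close> by linarith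
    finally have upper: "S s - s \<le> \<epsilon> * s + (C + 2 * (1 / \<eta> + 1))" by simp
    have "2 * (1 / \<eta> + 1) \<ge> 1 / \<eta> + 1" using \<eta> by (simp add: field_simps)
    then have "s - \<epsilon> * s - (C + 2 * (1 / \<eta> + 1)) \<le> (s - (\<eta> * s + (1 / \<eta> + 1))) - \<eta> * s - C"
      using mult_right_mono[OF \<eta>(3) that] \<open>0 \<le> \<eta> * s\<close> by linarith
    also have "\<dots> \<le> (real k)\<^sup>2 - \<eta> * (real k)\<^sup>2 - C"
      using sq_Suc gap sk \<open>\<eta> * (real k)\<^sup>2 \<le> \<eta> * s\<close> by linarith
    also have "\<dots> \<le> S ((real k)\<^sup>2)" using C(2)[of k] by simp
    also have "\<dots> \<le> S s" using that ks by (intro mono_onD[OF mono]) auto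
    finally show ?thesis using upper by linarith
  qed
  then show "\<exists>C. \<forall>s\<in>{0..}. \<bar>S s - s\<bar> \<le> \<epsilon> * s + C" by auto
qed

text \<open>At time \<open>k^2\<close> Chebyshev bounds the probability of a deviation of size
  \<epsilon> * \<open>k^2\<close> by a multiple of \<open>1 / k^2\<close>, which is summable. The
  condition \<open>S 0 = 0\<close> turns \<open>S t\<close> into an increment, so that its law is
  the Poisson law.\<close>

lemma (in prob_space) unit_poisson_process_sublinear:
  assumes S: "unit_poisson_process M S"
  shows "AE \<omega> in M. sublinear_on {0..} (\<lambda>s. s) (\<lambda>s. real (S s \<omega>) - s)"
proof -
  have meas[measurable]: "S t \<in> measurable M (count_space UNIV)" if "t \<ge> 0" for t
    using S that by (simp add: unit_poisson_process_def)
  have S0: "S 0 \<omega> = 0" if "\<omega> \<in> space M" for \<omega>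
    using S that by (simp add: unit_poisson_process_def)
  have mono: "mono_on {0..} (\<lambda>t. S t \<omega>)" if "\<omega> \<in> space M" for \<omega>
    using S that by (simp add: unit_poisson_process_def)
  have tail: "prob {\<omega>\<in>space M. \<bar>real (S t \<omega>) - t\<bar> \<ge> a} \<le> t / a\<^sup>2" if "t > 0" "a > 0" for t a
  proof -
    have [measurable]: "S t \<in> measurable M (count_space UNIV)" "S 0 \<in> measurable M (count_space UNIV)"
      using that by (auto intro: meas)
    have "measure (measure_pmf (poisson_pmf t)) {k. \<bar>real k - t\<bar> \<ge> a} =
        measure (distr M (count_space UNIV) (\<lambda>\<omega>. S t \<omega> - S 0 \<omega>)) {k. \<bar>real k - t\<bar> \<ge> a}"
      using S that by (simp add: unit_poisson_process_def)
    also have "\<dots> = prob ((\<lambda>\<omega>. S t \<omega> - S 0 \<omega>) -` {k. \<bar>real k - t\<bar> \<ge> a} \<inter> space M)"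
      by (rule measure_distr) auto
    also have "(\<lambda>\<omega>. S t \<omega> - S 0 \<omega>) -` {k. \<bar>real k - t\<bar> \<ge> a} \<inter> space M
        = {\<omega>\<in>space M. \<bar>real (S t \<omega>) - t\<bar> \<ge> a}"
      using S0 by auto
    finally show ?thesis using poisson_pmf_tail[OF that] by simp
  qed
  have "AE \<omega> in M. sublinear_on UNIV (\<lambda>k. (real k)\<^sup>2) (\<lambda>k. real (S ((real k)\<^sup>2) \<omega>) - (real k)\<^sup>2)"
  proof (rule AE_sublinear_of_summable_tails)
    show "random_variable borel (\<lambda>\<omega>. real (S ((real k)\<^sup>2) \<omega>) - (real k)\<^sup>2)" for k by measurable
  next
    fix \<epsilon> :: real assume "\<epsilon> > 0"
    show "summable (\<lambda>k. prob {\<omega>\<in>space M. \<bar>real (S ((real k)\<^sup>2) \<omega>) - (real k)\<^sup>2\<bar> \<ge> \<epsilon> * (real k)\<^sup>2})"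
    proof (rule summable_comparison_test')
      show "summable (\<lambda>k. (1 / \<epsilon>\<^sup>2) * inverse ((real k)\<^sup>2))"
        by (intro summable_mult inverse_power_summable) simp
      \<comment> \<open>At \<open>k = 0\<close> the event is certain while the bound is 0 because
        \<open>inverse 0 = 0\<close>; the comparison has to start at 1.\<close>
      fix k :: nat assume "k \<ge> 1"
      then show "norm (prob {\<omega>\<in>space M. \<bar>real (S ((real k)\<^sup>2) \<omega>) - (real k)\<^sup>2\<bar> \<ge> \<epsilon> * (real k)\<^sup>2})
          \<le> (1 / \<epsilon>\<^sup>2) * inverse ((real k)\<^sup>2)"
        using tail[of "(real k)\<^sup>2" "\<epsilon> * (real k)\<^sup>2"] \<open>\<epsilon> > 0\<close>
        by (simp add: power2_eq_square field_simps)
    qed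
  qed simp
  with AE_space show ?thesis
  proof eventually_elim
    case (elim \<omega>)
    have "mono_on {0..} (\<lambda>t. real (S t \<omega>))"
      using mono[OF elim(1)] by (auto simp: mono_on_def)
    then show ?case by (rule sublinear_of_squares) (use elim(2) in simp)
  qed
qed

text \<open>The indicators of \<open>X m = j\<close> are independent with values in
  \<open>[0, 1]\<close>, so Hoeffding's inequality gives geometric tails, summable along all
  integers.\<close>

lemma (in prob_space) iid_sequence_sublinear:
  fixes X :: "nat \<Rightarrow> 'a \<Rightarrow> 'b::finite"
  assumes X: "iid_sequence M p X"
  shows "AE \<omega> in M. sublinear_on UNIV real (\<lambda>n. real (routed (\<lambda>m. X m \<omega>) j n) - p j * real n)"
proof -
  have indep: "indep_vars (\<lambda>_. count_space UNIV) X {1..}"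
    using X by (simp add: iid_sequence_def)
  then have meas: "X m \<in> measurable M (count_space UNIV)" if "m \<ge> 1" for m
    using that by (auto simp: indep_vars_def)
  define Y where "Y m \<omega> = (if X m \<omega> = j then 1 else 0 :: real)" for m \<omega>
  have Ymeas: "Y m \<in> borel_measurable M" if "m \<ge> 1" for m
    unfolding Y_def using meas[OF that] by measurable
  have indepY: "indep_vars (\<lambda>_. borel) Y {1..n}" for n
    unfolding Y_def
    by (rule indep_vars_compose2[where Y = "\<lambda>_ x. if x = j then 1 else 0" and M' = "\<lambda>_. count_space UNIV"])
       (auto intro: indep_vars_subset[OF indep])
  have expY: "expectation (Y m) = p j" if "m \<ge> 1" for m
  proof -
    have "expectation (Y m) = expectation (indicator {\<omega>\<in>space M. X m \<omega> = j})"
      unfolding Y_def by (intro Bochner_Integration.integral_cong) (auto simp: indicator_def)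
    also have "\<dots> = p j"
      using X that by (simp add: iid_sequence_def Int_absorb2 subset_iff del: One_nat_def)
    finally show ?thesis .
  qed
  have routed: "real (routed (\<lambda>m. X m \<omega>) j n) = (\<Sum>m\<in>{1..n}. Y m \<omega>)" for \<omega> n
    by (simp add: routed_def Y_def sum.If_cases Int_def)
  have rv: "random_variable borel (\<lambda>\<omega>. \<Sum>m\<in>{1..n}. Y m \<omega>)" for n
    using Ymeas by (intro borel_measurable_sum) auto
  show ?thesis
  proof (rule AE_sublinear_of_summable_tails)
    show "random_variable borel (\<lambda>\<omega>. real (routed (\<lambda>m. X m \<omega>) j n) - p j * real n)" for n
      unfolding routed using rv[of n] by measurable
  next
    fix \<epsilon> :: real assume "\<epsilon> > 0"
    show "summable (\<lambda>n. prob {\<omega>\<in>space M. \<bar>real (routed (\<lambda>m. X m \<omega>) j n) - p j * real n\<bar> \<ge> \<epsilon> * real n})"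
    proof (rule summable_comparison_test')
      show "summable (\<lambda>n. 2 * exp (- 2 * \<epsilon>\<^sup>2) ^ n)"
        using \<open>\<epsilon> > 0\<close> by (intro summable_mult summable_geometric) simp
      fix n :: nat assume n: "n \<ge> 1"
      interpret Hoeffding_ineq M "{1..n}" Y "\<lambda>_. 0" "\<lambda>_. 1" "\<Sum>m\<in>{1..n}. expectation (Y m)"
        by unfold_locales (use indepY in \<open>auto simp: Y_def\<close>)
      have "prob {\<omega>\<in>space M. \<bar>(\<Sum>m\<in>{1..n}. Y m \<omega>) - p j * real n\<bar> \<ge> \<epsilon> * real n}
          \<le> 2 * exp (- 2 * (\<epsilon> * real n)\<^sup>2 / (\<Sum>m\<in>{1..n}. (1 - 0)\<^sup>2))"
        using Hoeffding_ineq_abs_ge[of "\<epsilon> * real n"] \<open>\<epsilon> > 0\<close> n by (simp add: expY mult.commute)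
      also have "- 2 * (\<epsilon> * real n)\<^sup>2 / (\<Sum>m\<in>{1..n}. (1 - 0)\<^sup>2) = real n * (- 2 * \<epsilon>\<^sup>2)"
        using n by (simp add: power2_eq_square field_simps)
      also have "exp (real n * (- 2 * \<epsilon>\<^sup>2)) = exp (- 2 * \<epsilon>\<^sup>2) ^ n"
        by (rule exp_of_nat_mult)
      finally show "norm (prob {\<omega>\<in>space M. \<bar>real (routed (\<lambda>m. X m \<omega>) j n) - p j * real n\<bar> \<ge> \<epsilon> * real n})
          \<le> 2 * exp (- 2 * \<epsilon>\<^sup>2) ^ n"
        unfolding routed by simp
    qed
  qed simp
qed

text \<open>The error splits into the routing error evaluated at the random count \<open>S s\<close>
  and \<open>p\<close> times the error of the clock itself; the first is controlled because
  \<open>S s\<close> grows at most linearly.\<close>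

lemma sublinear_of_routed:
  assumes S: "sublinear_on {0..} (\<lambda>s. s) (\<lambda>s. real (S s) - s)"
    and R: "sublinear_on UNIV real (\<lambda>n. real (R n) - p * real n)"
  shows "sublinear_on {0..} (\<lambda>s. s) (\<lambda>s. real (R (S s)) - p * s)"
proof (rule sublinear_onI)
  fix \<epsilon> :: real assume "\<epsilon> > 0"
  \<comment> \<open>The slopes add up to \<eta> * (2 + |p|): two units from the routing error at
    \<open>S s\<close>, using \<eta> \<le> 1, and |p| units from the clock.\<close>
  define \<eta> where "\<eta> = min 1 (\<epsilon> / (2 + \<bar>p\<bar>))"
  have "\<eta> * (2 + \<bar>p\<bar>) \<le> \<epsilon> / (2 + \<bar>p\<bar>) * (2 + \<bar>p\<bar>)"
    by (intro mult_right_mono) (auto simp: \<eta>_def)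
  then have \<eta>: "\<eta> > 0" "\<eta> \<le> 1" "\<eta> * (2 + \<bar>p\<bar>) \<le> \<epsilon>"
    using \<open>\<epsilon> > 0\<close> by (auto simp: \<eta>_def add_pos_nonneg)
  obtain C where C: "C \<ge> 0" "\<And>s. s \<ge> 0 \<Longrightarrow> \<bar>real (S s) - s\<bar> \<le> \<eta> * s + C"
    using sublinear_onE[OF S \<eta>(1)] by auto
  obtain D where D: "D \<ge> 0" "\<And>n. \<bar>real (R n) - p * real n\<bar> \<le> \<eta> * real n + D"
    using sublinear_onE[OF R \<eta>(1)] by auto
  have "\<bar>real (R (S s)) - p * s\<bar> \<le> \<epsilon> * s + (C + D + \<bar>p\<bar> * C)" if s: "s \<ge> 0" for s
  proof -
    have "\<bar>p * real (S s) - p * s\<bar> = \<bar>p\<bar> * \<bar>real (S s) - s\<bar>"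
      by (simp add: abs_mult[symmetric] algebra_simps)
    also have "\<dots> \<le> \<bar>p\<bar> * (\<eta> * s + C)" using C(2)[OF s] by (intro mult_left_mono) auto
    finally have 1: "\<bar>p * real (S s) - p * s\<bar> \<le> \<bar>p\<bar> * (\<eta> * s + C)" .
    have "\<eta> * real (S s) \<le> \<eta> * (s + (\<eta> * s + C))"
      using C(2)[OF s] \<eta> by (intro mult_left_mono) auto
    also have "\<dots> = \<eta> * s + \<eta> * (\<eta> * s + C)" by (simp add: algebra_simps)
    also have "\<dots> \<le> \<eta> * s + 1 * (\<eta> * s + C)"
      using \<eta> s C by (intro add_mono mult_right_mono) auto
    finally have 2: "\<eta> * real (S s) \<le> 2 * \<eta> * s + C" by simp
    have "\<bar>real (R (S s)) - p * s\<bar> \<le> 2 * \<eta> * s + C + D + \<bar>p\<bar> * (\<eta> * s + C)"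
      using 1 2 D(2)[of "S s"] by linarith
    also have "\<dots> = \<eta> * (2 + \<bar>p\<bar>) * s + (C + D + \<bar>p\<bar> * C)" by (simp add: algebra_simps)
    also have "\<dots> \<le> \<epsilon> * s + (C + D + \<bar>p\<bar> * C)"
      using \<eta> s by (intro add_right_mono mult_right_mono) auto
    finally show ?thesis .
  qed
  then show "\<exists>C. \<forall>s\<in>{0..}. \<bar>real (R (S s)) - p * s\<bar> \<le> \<epsilon> * s + C" by auto
qed

section \<open>Stability of the fluid equations\<close>

locale fluid_data =
  fixes lam :: "real^'r::finite" and \<mu> P Q :: "real^'r^'r"
  assumes lam_pos: "lam $ i > 0" and \<mu>_pos: "\<mu> $ i $ j > 0"
    and P_stoch: "row_stochastic P" and Q_stoch: "row_stochastic Q"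
begin

text \<open>The three drifts are the right-hand sides of the fluid equations with the initial state
  as a separate argument. A scaled path is thereby measured against the limiting initial state, and
  its own initial discrepancy becomes part of the error \<delta>.\<close>

definition f_drift :: "real^'r^'r \<Rightarrow> (real \<Rightarrow> real^'r^'r) \<Rightarrow> (real \<Rightarrow> real^'r) \<Rightarrow> real \<Rightarrow> 'r \<Rightarrow> 'r \<Rightarrow> real" where
  "f_drift f0 f u t i j = f0 $ i $ j + lam $ i * P $ i $ j * (t - u t $ i)
     - \<mu> $ i $ j * integral {0..t} (\<lambda>s. f s $ i $ j)"

definition transit_drift :: "real^'r^'r \<Rightarrow> (real \<Rightarrow> real^'r^'r) \<Rightarrow> (real \<Rightarrow> real^'r^'r) \<Rightarrow> real \<Rightarrow> 'r \<Rightarrow> 'r \<Rightarrow> real" where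
  "transit_drift e0 e f t i j = e0 $ i $ j - \<mu> $ i $ j * integral {0..t} (\<lambda>s. e s $ i $ j)
     + Q $ i $ j * (\<Sum>k\<in>UNIV. \<mu> $ k $ i * integral {0..t} (\<lambda>s. f s $ k $ i))"

definition station_drift :: "real^'r^'r \<Rightarrow> (real \<Rightarrow> real^'r^'r) \<Rightarrow> (real \<Rightarrow> real^'r^'r) \<Rightarrow> (real \<Rightarrow> real^'r) \<Rightarrow> real \<Rightarrow> 'r \<Rightarrow> real" where
  "station_drift e0 e f u t i = e0 $ i $ i - lam $ i * (t - u t $ i)
     + (\<Sum>j\<in>UNIV - {i}. \<mu> $ j $ i * integral {0..t} (\<lambda>s. e s $ j $ i))
     + Q $ i $ i * (\<Sum>j\<in>UNIV. \<mu> $ j $ i * integral {0..t} (\<lambda>s. f s $ j $ i))"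

text \<open>The last conjunct replaces \<open>\<integral>e\<^sub>i\<^sub>i du\<^sub>i = 0\<close>. It only mentions points below \<open>t\<close>, makes no
  reference to a measure, and is all that the comparison argument for the reflection term needs.\<close>

definition perturbed_fluid ::
  "real \<Rightarrow> real \<Rightarrow> real^'r^'r \<Rightarrow> real^'r^'r \<Rightarrow> (real \<Rightarrow> real^'r^'r) \<Rightarrow> (real \<Rightarrow> real^'r^'r) \<Rightarrow> (real \<Rightarrow> real^'r) \<Rightarrow> bool" where
  "perturbed_fluid T \<delta> e0 f0 e f u \<longleftrightarrow>
     (\<forall>i j. (\<lambda>s. e s $ i $ j) integrable_on {0..T} \<and> (\<lambda>s. f s $ i $ j) integrable_on {0..T}) \<and>
     (\<forall>t\<in>{0..T}. \<forall>i j. e t $ i $ j \<in> {0..1} \<and> f t $ i $ j \<in> {0..1}) \<and>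
     (\<forall>t\<in>{0..T}. \<forall>i j. \<bar>f t $ i $ j - f_drift f0 f u t i j\<bar> \<le> \<delta>) \<and>
     (\<forall>t\<in>{0..T}. \<forall>i j. i \<noteq> j \<longrightarrow> \<bar>e t $ i $ j - transit_drift e0 e f t i j\<bar> \<le> \<delta>) \<and>
     (\<forall>t\<in>{0..T}. \<forall>i. \<bar>e t $ i $ i - station_drift e0 e f u t i\<bar> \<le> \<delta>) \<and>
     (\<forall>t\<in>{0..T}. \<forall>i. 0 \<le> u t $ i) \<and> (\<forall>i. mono_on {0..T} (\<lambda>t. u t $ i)) \<and>
     (\<forall>t\<in>{0..T}. \<forall>i \<eta>. 0 < \<eta> \<and> \<eta> < u t $ i \<longrightarrow>
        (\<exists>s\<in>{0..t}. u t $ i - \<eta> \<le> u s $ i \<and> e s $ i $ i = 0))"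

lemma perturbed_fluidD:
  assumes "perturbed_fluid T \<delta> e0 f0 e f u"
  shows "(\<lambda>s. e s $ i $ j) integrable_on {0..T}" "(\<lambda>s. f s $ i $ j) integrable_on {0..T}"
    and "t \<in> {0..T} \<Longrightarrow> e t $ i $ j \<in> {0..1}" "t \<in> {0..T} \<Longrightarrow> f t $ i $ j \<in> {0..1}"
    and "t \<in> {0..T} \<Longrightarrow> \<bar>f t $ i $ j - f_drift f0 f u t i j\<bar> \<le> \<delta>"
    and "t \<in> {0..T} \<Longrightarrow> i \<noteq> j \<Longrightarrow> \<bar>e t $ i $ j - transit_drift e0 e f t i j\<bar> \<le> \<delta>"
    and "t \<in> {0..T} \<Longrightarrow> \<bar>e t $ i $ i - station_drift e0 e f u t i\<bar> \<le> \<delta>"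
    and "t \<in> {0..T} \<Longrightarrow> 0 \<le> u t $ i"
    and "mono_on {0..T} (\<lambda>t. u t $ i)"
    and "t \<in> {0..T} \<Longrightarrow> 0 < \<eta> \<Longrightarrow> \<eta> < u t $ i \<Longrightarrow>
        \<exists>s\<in>{0..t}. u t $ i - \<eta> \<le> u s $ i \<and> e s $ i $ i = 0"
  using assms unfolding perturbed_fluid_def by simp_all

lemma perturbed_fluidI:
  assumes "\<And>i j. (\<lambda>s. e s $ i $ j) integrable_on {0..T}" "\<And>i j. (\<lambda>s. f s $ i $ j) integrable_on {0..T}"
    and "\<And>t i j. t \<in> {0..T} \<Longrightarrow> e t $ i $ j \<in> {0..1}" "\<And>t i j. t \<in> {0..T} \<Longrightarrow> f t $ i $ j \<in> {0..1}"
    and "\<And>t i j. t \<in> {0..T} \<Longrightarrow> \<bar>f t $ i $ j - f_drift f0 f u t i j\<bar> \<le> \<delta>"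
    and "\<And>t i j. t \<in> {0..T} \<Longrightarrow> i \<noteq> j \<Longrightarrow> \<bar>e t $ i $ j - transit_drift e0 e f t i j\<bar> \<le> \<delta>"
    and "\<And>t i. t \<in> {0..T} \<Longrightarrow> \<bar>e t $ i $ i - station_drift e0 e f u t i\<bar> \<le> \<delta>"
    and "\<And>t i. t \<in> {0..T} \<Longrightarrow> 0 \<le> u t $ i"
    and "\<And>i. mono_on {0..T} (\<lambda>t. u t $ i)"
    and "\<And>t i \<eta>. t \<in> {0..T} \<Longrightarrow> 0 < \<eta> \<Longrightarrow> \<eta> < u t $ i \<Longrightarrow>
        \<exists>s\<in>{0..t}. u t $ i - \<eta> \<le> u s $ i \<and> e s $ i $ i = 0"
  shows "perturbed_fluid T \<delta> e0 f0 e f u"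
  unfolding perturbed_fluid_def
  by (intro conjI allI ballI impI; (elim conjE)?; rule assms; assumption)

text \<open>Lipschitz comparison for one-dimensional reflection, without the explicit
  running-supremum formula: up to \<eta>, \<open>v\<close> has reached its value at time
  \<open>t\<close> already at a zero of \<open>e\<close>; there the free processes bound
  \<open>v\<close> by \<open>v'\<close>, and monotonicity carries \<open>v'\<close> on to
  \<open>t\<close>. The estimate is one-sided, so \<open>e\<close> supplies the zeros and
  \<open>e'\<close> only its sign.\<close>

lemma reflection_le:
  fixes e e' v v' :: "real \<Rightarrow> real"
  assumes "c > 0" "d \<ge> 0"
    and t: "t \<ge> 0"
    and e': "\<And>s. s \<in> {0..t} \<Longrightarrow> 0 \<le> e' s"
    and v': "mono_on {0..t} v'" "0 \<le> v' t"
    and compl: "\<And>\<eta>. 0 < \<eta> \<Longrightarrow> \<eta> < v t \<Longrightarrow> \<exists>s\<in>{0..t}. v t - \<eta> \<le> v s \<and> e s = 0"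
    and free: "\<And>s. s \<in> {0..t} \<Longrightarrow> \<bar>(e s - c * v s) - (e' s - c * v' s)\<bar> \<le> d"
  shows "c * (v t - v' t) \<le> d"
proof -
  have "v t \<le> (v' t + d / c) + \<eta>" if \<eta>: "\<eta> > 0" for \<eta>
  proof (cases "\<eta> < v t")
    case True
    then obtain s where s: "s \<in> {0..t}" "v t - \<eta> \<le> v s" "e s = 0"
      using compl[OF \<eta>] by blast
    \<comment> \<open>At a zero of \<open>e\<close> the first free process equals
      \<open>- c * v s\<close>, while \<open>e' s\<close> \<ge> 0 keeps the second one above
      \<open>- c * v' s\<close>.\<close>
    have "c * v s \<le> d + c * v' s"
      using free[OF s(1)] e'[OF s(1)] s(3) by linarith
    also have "\<dots> \<le> d + c * v' t"
      using s(1) \<open>c > 0\<close> by (intro add_left_mono mult_left_mono mono_onD[OF v'(1)]) auto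
    finally have "v s \<le> v' t + d / c"
      using \<open>c > 0\<close> by (simp add: field_simps)
    with s(2) show ?thesis by linarith
  next
    case False
    moreover have "d / c \<ge> 0" using assms by simp
    ultimately show ?thesis using v'(2) by linarith
  qed
  then have "v t \<le> v' t + d / c" by (rule field_le_epsilon)
  then show ?thesis using \<open>c > 0\<close> by (simp add: field_simps)
qed

section \<open>Bounds on rates and routing probabilities, and the one-step comparison\<close>

definition \<mu>_total :: real where "\<mu>_total = (\<Sum>i\<in>UNIV. \<Sum>j\<in>UNIV. \<mu> $ i $ j)"

lemma column_le_\<mu>_total: "(\<Sum>k\<in>A. \<mu> $ k $ i) \<le> \<mu>_total"
proof -
  have "(\<Sum>k\<in>A. \<mu> $ k $ i) \<le> (\<Sum>k\<in>UNIV. \<mu> $ k $ i)"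
    by (intro sum_mono2) (auto intro: less_imp_le[OF \<mu>_pos])
  also have "\<dots> \<le> \<mu>_total"
    unfolding \<mu>_total_def
    by (intro sum_mono member_le_sum) (auto intro: less_imp_le[OF \<mu>_pos])
  finally show ?thesis .
qed

lemma \<mu>_le_\<mu>_total: "\<mu> $ k $ i \<le> \<mu>_total"
  using column_le_\<mu>_total[of i "{k}"] by simp

lemma \<mu>_total_pos: "\<mu>_total > 0"
  using \<mu>_le_\<mu>_total \<mu>_pos by (rule order.strict_trans2[rotated])

lemma P_bounds: "0 \<le> P $ i $ j" "P $ i $ j \<le> 1"
  and Q_bounds: "0 \<le> Q $ i $ j" "Q $ i $ j \<le> 1"
proof -
  have "A $ i $ j \<le> 1" if "row_stochastic A" for A :: "real^'r^'r"
    using member_le_sum[of j UNIV "\<lambda>j. A $ i $ j"] that by (auto simp: row_stochastic_def)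
  with P_stoch Q_stoch show "0 \<le> P $ i $ j" "P $ i $ j \<le> 1" "0 \<le> Q $ i $ j" "Q $ i $ j \<le> 1"
    by (auto simp: row_stochastic_def)
qed

lemma weighted_column_diff_le:
  assumes "\<And>k. \<bar>x k - y k\<bar> \<le> B"
  shows "\<bar>(\<Sum>k\<in>A. \<mu> $ k $ i * x k) - (\<Sum>k\<in>A. \<mu> $ k $ i * y k)\<bar> \<le> \<mu>_total * B"
proof -
  have B: "B \<ge> 0" using assms[of undefined] by linarith
  have "\<bar>(\<Sum>k\<in>A. \<mu> $ k $ i * x k) - (\<Sum>k\<in>A. \<mu> $ k $ i * y k)\<bar> = \<bar>\<Sum>k\<in>A. \<mu> $ k $ i * (x k - y k)\<bar>"
    by (simp add: sum_subtractf right_diff_distrib)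
  also have "\<dots> \<le> (\<Sum>k\<in>A. \<bar>\<mu> $ k $ i * (x k - y k)\<bar>)" by (rule sum_abs)
  also have "\<dots> \<le> (\<Sum>k\<in>A. \<mu> $ k $ i * B)"
    using assms less_imp_le[OF \<mu>_pos] by (intro sum_mono) (simp add: abs_mult mult_left_mono)
  also have "\<dots> \<le> \<mu>_total * B"
    using column_le_\<mu>_total B by (simp add: sum_distrib_right[symmetric] mult_right_mono)
  finally show ?thesis .
qed

text \<open>The inequality that Gronwall iterates: \<open>B\<close> bounds the differences of all
  time integrals up to \<open>t\<close>. Reflection comes first, and the bound on \<open>u\<close>
  then feeds the other equations. The worst case of the final constants is the diagonal of
  \<open>e\<close>, which pays once for its free process and once more for the reflection term;
  \<open>f\<close> would need only 3 instead of 4.\<close>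

lemma perturbed_fluid_step:
  assumes x: "perturbed_fluid T \<delta> e0 f0 e f u" and x': "perturbed_fluid T \<delta>' e0 f0 e' f' u'"
    and t: "t \<in> {0..T}"
    and Be: "\<And>s i j. s \<in> {0..t} \<Longrightarrow> \<bar>integral {0..s} (\<lambda>r. e r $ i $ j) - integral {0..s} (\<lambda>r. e' r $ i $ j)\<bar> \<le> B"
    and Bf: "\<And>s i j. s \<in> {0..t} \<Longrightarrow> \<bar>integral {0..s} (\<lambda>r. f r $ i $ j) - integral {0..s} (\<lambda>r. f' r $ i $ j)\<bar> \<le> B"
  shows "lam $ i * \<bar>u t $ i - u' t $ i\<bar> \<le> \<delta> + \<delta>' + 2 * \<mu>_total * B"
    and "\<bar>e t $ i $ j - e' t $ i $ j\<bar> \<le> 2 * (\<delta> + \<delta>') + 4 * \<mu>_total * B"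
    and "\<bar>f t $ i $ j - f' t $ i $ j\<bar> \<le> 2 * (\<delta> + \<delta>') + 4 * \<mu>_total * B"
proof -
  note D = perturbed_fluidD[OF x] and D' = perturbed_fluidD[OF x']
  have B: "B \<ge> 0" using Be[of 0 undefined undefined] t by auto
  define W where "W = \<mu>_total * B"
  have KB: "\<mu>_total * B \<ge> 0" using B \<mu>_total_pos by simp
  have \<delta>: "\<delta> + \<delta>' \<ge> 0" using D(5)[OF t, of undefined undefined] D'(5)[OF t, of undefined undefined] by linarith
  have Qsum: "\<bar>Q $ i $ j * (\<Sum>k\<in>UNIV. \<mu> $ k $ i * integral {0..s} (\<lambda>r. f r $ k $ i))
      - Q $ i $ j * (\<Sum>k\<in>UNIV. \<mu> $ k $ i * integral {0..s} (\<lambda>r. f' r $ k $ i))\<bar> \<le> \<mu>_total * B"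
    if "s \<in> {0..t}" for i j s
  proof -
    have "\<bar>Q $ i $ j * (\<Sum>k\<in>UNIV. \<mu> $ k $ i * integral {0..s} (\<lambda>r. f r $ k $ i))
      - Q $ i $ j * (\<Sum>k\<in>UNIV. \<mu> $ k $ i * integral {0..s} (\<lambda>r. f' r $ k $ i))\<bar>
      = Q $ i $ j * \<bar>(\<Sum>k\<in>UNIV. \<mu> $ k $ i * integral {0..s} (\<lambda>r. f r $ k $ i))
      - (\<Sum>k\<in>UNIV. \<mu> $ k $ i * integral {0..s} (\<lambda>r. f' r $ k $ i))\<bar>"
      using Q_bounds by (simp add: abs_mult right_diff_distrib[symmetric])
    also have "\<dots> \<le> 1 * (\<mu>_total * B)"
      using Q_bounds Bf[OF that] by (intro mult_mono weighted_column_diff_le) auto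
    finally show ?thesis by simp
  qed
  have \<mu>B: "\<bar>\<mu> $ i $ j * y - \<mu> $ i $ j * z\<bar> \<le> \<mu>_total * B" if "\<bar>y - z\<bar> \<le> B" for i j y z
  proof -
    have "\<bar>\<mu> $ i $ j * y - \<mu> $ i $ j * z\<bar> = \<mu> $ i $ j * \<bar>y - z\<bar>"
      using less_imp_le[OF \<mu>_pos] by (simp add: abs_mult right_diff_distrib[symmetric])
    also have "\<dots> \<le> \<mu>_total * B"
      using that less_imp_le[OF \<mu>_pos] \<mu>_le_\<mu>_total less_imp_le[OF \<mu>_total_pos] by (intro mult_mono) auto
    finally show ?thesis .
  qed
  \<comment> \<open>Subtracting \<open>lam * u\<close> cancels the reflection term of the drift, so
    that the difference consists of integrals only: one column of transit terms and one of routed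
    terms, each at most \<open>\<mu>_total * B\<close>.\<close>
  have free: "\<bar>(e s $ i $ i - lam $ i * u s $ i) - (e' s $ i $ i - lam $ i * u' s $ i)\<bar> \<le> \<delta> + \<delta>' + 2 * \<mu>_total * B"
    if s: "s \<in> {0..t}" for s i
  proof -
    have sT: "s \<in> {0..T}" using s t by auto
    have "\<bar>(\<Sum>k\<in>UNIV - {i}. \<mu> $ k $ i * integral {0..s} (\<lambda>r. e r $ k $ i))
        - (\<Sum>k\<in>UNIV - {i}. \<mu> $ k $ i * integral {0..s} (\<lambda>r. e' r $ k $ i))\<bar> \<le> \<mu>_total * B"
      by (rule weighted_column_diff_le[OF Be[OF s]])
    then have "\<bar>(station_drift e0 e f u s i - lam $ i * u s $ i) - (station_drift e0 e' f' u' s i - lam $ i * u' s $ i)\<bar>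
        \<le> \<mu>_total * B + \<mu>_total * B"
      unfolding station_drift_def right_diff_distrib
      using Qsum[OF s, of i i]
      by linarith
    then show ?thesis using D(7)[OF sT, of i] D'(7)[OF sT, of i] by linarith
  qed
  have u1: "lam $ i * (u t $ i - u' t $ i) \<le> \<delta> + \<delta>' + 2 * \<mu>_total * B" for i
  proof (rule reflection_le[where e = "\<lambda>s. e s $ i $ i" and e' = "\<lambda>s. e' s $ i $ i" and v = "\<lambda>s. u s $ i" and v' = "\<lambda>s. u' s $ i"])
    show "lam $ i > 0" by (rule lam_pos)
    show "0 \<le> \<delta> + \<delta>' + 2 * \<mu>_total * B" using \<delta> KB by linarith
    show "0 \<le> t" using t by simp
    show "0 \<le> e' s $ i $ i" if "s \<in> {0..t}" for s using D'(3)[of s i i] that t by auto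
    show "mono_on {0..t} (\<lambda>s. u' s $ i)" by (rule mono_on_subset[OF D'(9)]) (use t in auto)
    show "0 \<le> u' t $ i" by (rule D'(8)[OF t])
    show "\<exists>s\<in>{0..t}. u t $ i - \<eta> \<le> u s $ i \<and> e s $ i $ i = 0" if "0 < \<eta>" "\<eta> < u t $ i" for \<eta>
      by (rule D(10)[OF t that])
  qed (rule free)
  \<comment> \<open>The same comparison with the roles exchanged: now the zeros come from the second
    solution and the sign from the first.\<close>
  have u2: "lam $ i * (u' t $ i - u t $ i) \<le> \<delta> + \<delta>' + 2 * \<mu>_total * B" for i
  proof (rule reflection_le[where e' = "\<lambda>s. e s $ i $ i" and e = "\<lambda>s. e' s $ i $ i" and v' = "\<lambda>s. u s $ i" and v = "\<lambda>s. u' s $ i"])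
    show "lam $ i > 0" by (rule lam_pos)
    show "0 \<le> \<delta> + \<delta>' + 2 * \<mu>_total * B" using \<delta> KB by linarith
    show "0 \<le> t" using t by simp
    show "0 \<le> e s $ i $ i" if "s \<in> {0..t}" for s using D(3)[of s i i] that t by auto
    show "mono_on {0..t} (\<lambda>s. u s $ i)" by (rule mono_on_subset[OF D(9)]) (use t in auto)
    show "0 \<le> u t $ i" by (rule D(8)[OF t])
    show "\<exists>s\<in>{0..t}. u' t $ i - \<eta> \<le> u' s $ i \<and> e' s $ i $ i = 0" if "0 < \<eta>" "\<eta> < u' t $ i" for \<eta>
      by (rule D'(10)[OF t that])
  qed (subst abs_minus_commute, rule free)
  have u: "lam $ i * \<bar>u t $ i - u' t $ i\<bar> \<le> \<delta> + \<delta>' + 2 * \<mu>_total * B" for i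
    using u1[of i] u2[of i] by (cases "u t $ i \<le> u' t $ i") auto
  then show "lam $ i * \<bar>u t $ i - u' t $ i\<bar> \<le> \<delta> + \<delta>' + 2 * \<mu>_total * B" .
  have tt: "t \<in> {0..t}" using t by auto
  show "\<bar>e t $ i $ j - e' t $ i $ j\<bar> \<le> 2 * (\<delta> + \<delta>') + 4 * \<mu>_total * B"
  proof (cases "i = j")
    case True
    have "\<bar>lam $ i * u t $ i - lam $ i * u' t $ i\<bar> \<le> \<delta> + \<delta>' + 2 * \<mu>_total * B"
      using u[of i] less_imp_le[OF lam_pos] by (simp add: abs_mult right_diff_distrib[symmetric])
    then show ?thesis using free[OF tt, of i] True by (simp; linarith)
  next
    case False
    have "\<bar>transit_drift e0 e f t i j - transit_drift e0 e' f' t i j\<bar> \<le> \<mu>_total * B + \<mu>_total * B"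
      unfolding transit_drift_def using \<mu>B[OF Be[OF tt, of i j], of i j] Qsum[OF tt, of i j] by linarith
    then have "\<bar>e t $ i $ j - e' t $ i $ j\<bar> \<le> \<delta> + \<delta>' + (W + W)"
      using D(6)[OF t False] D'(6)[OF t False] unfolding W_def[symmetric] by linarith
    then show ?thesis using \<delta> KB unfolding mult.assoc W_def[symmetric] by argo
  qed
  have split: "\<bar>(x + a - b) - (x + a' - b')\<bar> \<le> \<bar>a - a'\<bar> + \<bar>b - b'\<bar>" for x a a' b b' :: real
    by linarith
  have "\<bar>lam $ i * P $ i $ j * (t - u t $ i) - lam $ i * P $ i $ j * (t - u' t $ i)\<bar> = P $ i $ j * (lam $ i * \<bar>u t $ i - u' t $ i\<bar>)"
    using less_imp_le[OF lam_pos] P_bounds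
    by (simp add: right_diff_distrib[symmetric] abs_mult abs_minus_commute)
  also have "\<dots> \<le> 1 * (\<delta> + \<delta>' + 2 * \<mu>_total * B)"
    using P_bounds u less_imp_le[OF lam_pos] by (intro mult_mono mult_nonneg_nonneg) auto
  finally have "\<bar>lam $ i * P $ i $ j * (t - u t $ i) - lam $ i * P $ i $ j * (t - u' t $ i)\<bar> \<le> \<delta> + \<delta>' + 2 * \<mu>_total * B"
    by simp
  then have "\<bar>f_drift f0 f u t i j - f_drift f0 f' u' t i j\<bar> \<le> (\<delta> + \<delta>' + 2 * \<mu>_total * B) + \<mu>_total * B"
    unfolding f_drift_def
    by (rule order_trans[OF split add_mono[OF _ \<mu>B[OF Bf[OF tt]]]])
  then have "\<bar>f t $ i $ j - f' t $ i $ j\<bar> \<le> 2 * (\<delta> + \<delta>') + 3 * W"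
    using D(5)[OF t, of i j] D'(5)[OF t, of i j] unfolding mult.assoc W_def[symmetric] by argo
  then show "\<bar>f t $ i $ j - f' t $ i $ j\<bar> \<le> 2 * (\<delta> + \<delta>') + 4 * \<mu>_total * B"
    using KB unfolding mult.assoc W_def[symmetric] by argo
qed

text \<open>The value makes \<open>4 * \<mu>_total / rate\<close> equal to 1/2, so that one step of
  the comparison is a contraction in the weighted supremum.\<close>

definition rate :: real where "rate = 8 * \<mu>_total"

text \<open>The 4 comes from solving \<open>m \<le> 2 * d + m / 2\<close> for \<open>m\<close>,
  where \<open>d\<close> is the sum of the two errors; the exponential undoes the weight at time
  \<open>T\<close>, and the last factor turns a bound on \<open>lam * u\<close> into one on
  \<open>u\<close>.\<close>

definition stability_const :: "real \<Rightarrow> real" where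
  "stability_const T = 4 * exp (rate * T) * (1 + (\<Sum>i\<in>UNIV. 1 / lam $ i))"

text \<open>Integrating the exponential weight gains the factor \<open>1 / L\<close>; this is the
  source of the contraction.\<close>

lemma integral_diff_exp_bound:
  fixes x y :: "real \<Rightarrow> real"
  assumes "x integrable_on {0..T}" "y integrable_on {0..T}" "s \<in> {0..T}" "L > 0" "M \<ge> 0"
    and le: "\<And>r. r \<in> {0..T} \<Longrightarrow> \<bar>x r - y r\<bar> \<le> M * exp (L * r)"
  shows "\<bar>integral {0..s} x - integral {0..s} y\<bar> \<le> M * exp (L * s) / L"
proof -
  have int: "x integrable_on {0..s}" "y integrable_on {0..s}"
    using assms by (auto intro: integrable_subinterval_real)
  have "((\<lambda>r. M * exp (L * r)) has_integral (M * exp (L * s) / L - M * exp (L * 0) / L)) {0..s}"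
    using assms by (intro fundamental_theorem_of_calculus)
      (auto intro!: derivative_eq_intros simp: has_real_derivative_iff_has_vector_derivative[symmetric])
  then have E: "(\<lambda>r. M * exp (L * r)) integrable_on {0..s}"
      "integral {0..s} (\<lambda>r. M * exp (L * r)) = M * exp (L * s) / L - M / L"
    by (auto simp: has_integral_iff)
  have "\<bar>integral {0..s} x - integral {0..s} y\<bar> = norm (integral {0..s} (\<lambda>r. x r - y r))"
    using int by (simp add: integral_diff)
  also have "\<dots> \<le> integral {0..s} (\<lambda>r. M * exp (L * r))"
    using assms by (intro integral_norm_bound_integral integrable_diff int E) auto
  moreover have "M / L \<ge> 0" using assms(4,5) by simp
  ultimately show ?thesis using E(2) by linarith
qed

text \<open>Gronwall's argument in the form: the supremum \<open>m\<close> of the differences weighted by \<open>exp (- L t)\<close>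
  satisfies \<open>m \<le> 2\<delta> + m / 2\<close>.\<close>

lemma perturbed_fluid_stability:
  assumes x: "perturbed_fluid T \<delta> e0 f0 e f u" and x': "perturbed_fluid T \<delta>' e0 f0 e' f' u'"
    and t: "t \<in> {0..T}"
  shows "\<bar>e t $ i $ j - e' t $ i $ j\<bar> \<le> stability_const T * (\<delta> + \<delta>')"
    and "\<bar>f t $ i $ j - f' t $ i $ j\<bar> \<le> stability_const T * (\<delta> + \<delta>')"
    and "\<bar>u t $ i - u' t $ i\<bar> \<le> stability_const T * (\<delta> + \<delta>')"
proof -
  note D = perturbed_fluidD[OF x] and D' = perturbed_fluidD[OF x']
  have \<delta>: "\<delta> + \<delta>' \<ge> 0" using D(5)[OF t, of undefined undefined] D'(5)[OF t, of undefined undefined] by linarith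
  have L: "rate > 0" using \<mu>_total_pos by (simp add: rate_def)
  \<comment> \<open>The reflection terms are left out: they have no a priori bound here like that of
    the states, and are recovered from \<open>e\<close> and \<open>f\<close> at the end.\<close>
  define A where "A = {exp (- rate * t) * \<bar>e t $ i $ j - e' t $ i $ j\<bar> |t i j. t \<in> {0..T}} \<union>
      {exp (- rate * t) * \<bar>f t $ i $ j - f' t $ i $ j\<bar> |t i j. t \<in> {0..T}}"
  define m where "m = Sup A"
  \<comment> \<open>States lie in \<open>[0, 1]\<close>, so the supremum is finite; without this an
    inequality \<open>m \<le> 2 * d + m / 2\<close> could not be solved for
    \<open>m\<close>.\<close>
  have "a \<le> 1" if "a \<in> A" for a
  proof -
    have *: "exp (- rate * s) * \<bar>y - z\<bar> \<le> 1" if "s \<in> {0..T}" "y \<in> {0..1}" "z \<in> {0..1}" for s y z :: real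
      using that L by (intro mult_le_one) auto
    show ?thesis
      using that *[OF _ D(3) D'(3)] *[OF _ D(4) D'(4)] unfolding A_def by blast
  qed
  then have bdd: "bdd_above A" by (rule bdd_aboveI)
  have Ae: "exp (- rate * t) * \<bar>e t $ i $ j - e' t $ i $ j\<bar> \<in> A"
    and Af: "exp (- rate * t) * \<bar>f t $ i $ j - f' t $ i $ j\<bar> \<in> A" if "t \<in> {0..T}" for t i j
    using that unfolding A_def by blast+
  have le_m: "\<bar>e t $ i $ j - e' t $ i $ j\<bar> \<le> m * exp (rate * t)"
      "\<bar>f t $ i $ j - f' t $ i $ j\<bar> \<le> m * exp (rate * t)" if "t \<in> {0..T}" for t i j
    using cSup_upper[OF Ae[OF that, of i j] bdd] cSup_upper[OF Af[OF that, of i j] bdd]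
    unfolding m_def[symmetric] by (simp_all add: exp_minus field_simps)
  have m_nonneg: "m \<ge> 0"
    using cSup_upper[OF Ae[OF t] bdd, of undefined undefined] unfolding m_def[symmetric]
    by (rule order_trans[rotated]) simp
  have Be: "\<bar>integral {0..s} (\<lambda>r. e r $ i $ j) - integral {0..s} (\<lambda>r. e' r $ i $ j)\<bar> \<le> m * exp (rate * t) / rate"
    and Bf: "\<bar>integral {0..s} (\<lambda>r. f r $ i $ j) - integral {0..s} (\<lambda>r. f' r $ i $ j)\<bar> \<le> m * exp (rate * t) / rate"
    if "t \<in> {0..T}" "s \<in> {0..t}" for s t i j
  proof -
    have s: "s \<in> {0..T}" using that by auto
    have *: "m * exp (rate * s) / rate \<le> m * exp (rate * t) / rate"
      using that L m_nonneg by (intro divide_right_mono mult_left_mono) auto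
    show "\<bar>integral {0..s} (\<lambda>r. e r $ i $ j) - integral {0..s} (\<lambda>r. e' r $ i $ j)\<bar> \<le> m * exp (rate * t) / rate"
      using integral_diff_exp_bound[OF D(1) D'(1) s L m_nonneg le_m(1)] * by (rule order_trans)
    show "\<bar>integral {0..s} (\<lambda>r. f r $ i $ j) - integral {0..s} (\<lambda>r. f' r $ i $ j)\<bar> \<le> m * exp (rate * t) / rate"
      using integral_diff_exp_bound[OF D(2) D'(2) s L m_nonneg le_m(2)] * by (rule order_trans)
  qed
  have "a \<le> 2 * (\<delta> + \<delta>') + m / 2" if "a \<in> A" for a
  proof -
    \<comment> \<open>By the choice of \<open>rate\<close> the integral term is half of
      \<open>m * exp (rate * t)\<close>, and the weight removes the exponential.\<close>
    have *: "exp (- rate * t) * y \<le> 2 * (\<delta> + \<delta>') + m / 2"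
      if "t \<in> {0..T}" "y \<le> 2 * (\<delta> + \<delta>') + 4 * \<mu>_total * (m * exp (rate * t) / rate)" for t y
    proof -
      have "4 * \<mu>_total * (m * exp (rate * t) / rate) = m * exp (rate * t) / 2"
        using L by (simp add: rate_def)
      then have "exp (- rate * t) * y \<le> exp (- rate * t) * (2 * (\<delta> + \<delta>') + m * exp (rate * t) / 2)"
        using that by (intro mult_left_mono) auto
      also have "\<dots> = exp (- rate * t) * (2 * (\<delta> + \<delta>')) + m / 2"
        by (simp add: exp_minus field_simps)
      also have "exp (- rate * t) * (2 * (\<delta> + \<delta>')) \<le> 1 * (2 * (\<delta> + \<delta>'))"
        using that L \<delta> by (intro mult_right_mono) auto
      finally show ?thesis by simp
    qed
    have "\<exists>t y. t \<in> {0..T} \<and> a = exp (- rate * t) * y \<and>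
        y \<le> 2 * (\<delta> + \<delta>') + 4 * \<mu>_total * (m * exp (rate * t) / rate)"
      using \<open>a \<in> A\<close> perturbed_fluid_step(2,3)[OF x x' _ Be Bf] unfolding A_def by blast
    then show ?thesis using * by blast
  qed
  then have "m \<le> 2 * (\<delta> + \<delta>') + m / 2"
    unfolding m_def using Ae[OF t] by (intro cSup_least) auto
  then have m: "m \<le> 4 * (\<delta> + \<delta>')" by simp
  define c where "c = (\<Sum>i\<in>UNIV. 1 / lam $ i)"
  have c: "1 / lam $ i \<le> c" for i
    unfolding c_def using less_imp_le[OF lam_pos] by (intro member_le_sum) auto
  have c0: "c > 0" using c[of undefined] lam_pos[of undefined] by (smt (verit) divide_pos_pos)
  have "m * exp (rate * t) \<le> (4 * (\<delta> + \<delta>')) * exp (rate * T)"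
    using m t L \<delta> by (intro mult_mono) auto
  also have "\<dots> \<le> 4 * exp (rate * T) * (1 + c) * (\<delta> + \<delta>')"
  proof -
    have "(4 * exp (rate * T) * (\<delta> + \<delta>')) * 1 \<le> (4 * exp (rate * T) * (\<delta> + \<delta>')) * (1 + c)"
      using \<delta> c0 by (intro mult_left_mono) auto
    then show ?thesis by (simp only: mult_1_right mult_ac)
  qed
  finally have *: "m * exp (rate * t) \<le> stability_const T * (\<delta> + \<delta>')"
    by (simp add: stability_const_def c_def)
  show "\<bar>e t $ i $ j - e' t $ i $ j\<bar> \<le> stability_const T * (\<delta> + \<delta>')"
    "\<bar>f t $ i $ j - f' t $ i $ j\<bar> \<le> stability_const T * (\<delta> + \<delta>')"
    using le_m[OF t, of i j] * by (auto intro: order_trans)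
  \<comment> \<open>With \<open>m\<close> under control, one more application of the step lemma
    bounds the reflection terms; its coefficient 2 in place of 4 leaves a quarter of the
    exponential.\<close>
  have "lam $ i * \<bar>u t $ i - u' t $ i\<bar> \<le> (\<delta> + \<delta>') + 2 * \<mu>_total * (m * exp (rate * t) / rate)"
    using perturbed_fluid_step(1)[OF x x' t Be[OF t] Bf[OF t]] by simp
  also have "2 * \<mu>_total * (m * exp (rate * t) / rate) = m * exp (rate * t) / 4"
    using L by (simp add: rate_def)
  also have "\<dots> \<le> ((4 * (\<delta> + \<delta>')) * exp (rate * T)) / 4"
    using m t L \<delta> by (intro divide_right_mono mult_mono) auto
  also have "\<dots> = exp (rate * T) * (\<delta> + \<delta>')" by simp
  also have "(\<delta> + \<delta>') + exp (rate * T) * (\<delta> + \<delta>') = (1 + exp (rate * T)) * (\<delta> + \<delta>')"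
    by (simp add: algebra_simps)
  also have "\<dots> \<le> (4 * exp (rate * T)) * (\<delta> + \<delta>')"
  proof (rule mult_right_mono[OF _ \<delta>])
    have "exp (rate * T) \<ge> 1" using t L by simp
    then show "1 + exp (rate * T) \<le> 4 * exp (rate * T)" by linarith
  qed
  finally have "\<bar>u t $ i - u' t $ i\<bar> \<le> (4 * exp (rate * T) * (\<delta> + \<delta>')) * (1 / lam $ i)"
    using lam_pos[of i] by (simp add: field_simps)
  also have "\<dots> \<le> (4 * exp (rate * T) * (\<delta> + \<delta>')) * (1 + c)"
    using c[of i] \<delta> by (intro mult_left_mono) auto
  finally show "\<bar>u t $ i - u' t $ i\<bar> \<le> stability_const T * (\<delta> + \<delta>')"
    by (simp add: stability_const_def c_def mult_ac)
qed

end

section \<open>Right-continuous paths and Stieltjes complementarity\<close>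

text \<open>The path is frozen at \<open>x 0\<close> on the negative axis and written as a pointwise
  limit of step functions, whose value at \<open>t\<close> is the value of the path at the next grid
  point of mesh \<open>1 / Suc n\<close>. Each of them factors through the integer-valued floor
  function.\<close>

lemma right_continuous_borel_measurable:
  fixes x :: "real \<Rightarrow> real"
  assumes "\<And>t. t \<ge> 0 \<Longrightarrow> (x \<longlongrightarrow> x t) (at_right t)"
  shows "(\<lambda>t. x (max 0 t)) \<in> borel_measurable borel"
    and "((\<lambda>t. x (max 0 t)) \<longlongrightarrow> x (max 0 t)) (at_right t)"
proof -
  define g where "g t = x (max 0 t)" for t
  have g: "(g \<longlongrightarrow> g t) (at_right t)" for t
  proof (cases "t \<ge> 0")
    case True
    have "eventually (\<lambda>s. s > t) (at_right t)" by (simp add: eventually_at_right_less)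
    then have "eventually (\<lambda>s. x s = g s) (at_right t)"
      by eventually_elim (use True in \<open>simp add: g_def\<close>)
    then have "(g \<longlongrightarrow> x t) (at_right t)"
      using assms[OF True] by (rule Lim_transform_eventually[rotated])
    then show ?thesis using True by (simp add: g_def)
  next
    case False
    then have "eventually (\<lambda>s. s < 0) (at_right t)"
      by (auto simp: eventually_at_right_field intro!: exI[of _ 0])
    then have "eventually (\<lambda>s. x 0 = g s) (at_right t)"
      by eventually_elim (simp add: g_def)
    then have "(g \<longlongrightarrow> x 0) (at_right t)"
      using tendsto_const by (rule Lim_transform_eventually[rotated])
    then show ?thesis using False by (simp add: g_def)
  qed
  then show "((\<lambda>t. x (max 0 t)) \<longlongrightarrow> x (max 0 t)) (at_right t)"
    unfolding g_def .
  \<comment> \<open>Floor plus one instead of a ceiling: the grid point must lie strictly to the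
    right of \<open>t\<close>, as \<open>at_right t\<close> excludes \<open>t\<close>
    itself.\<close>
  define a where "a n t = (real_of_int \<lfloor>t * Suc n\<rfloor> + 1) / Suc n" for n :: nat and t :: real
  have a: "t < a n t" "a n t \<le> t + inverse (Suc n)" for n t
  proof -
    have "t * Suc n < real_of_int \<lfloor>t * Suc n\<rfloor> + 1" "real_of_int \<lfloor>t * Suc n\<rfloor> \<le> t * Suc n"
      by linarith+
    then show "t < a n t" "a n t \<le> t + inverse (Suc n)"
      unfolding a_def by (simp_all add: field_simps del: of_nat_Suc)
  qed
  have "g \<in> borel_measurable borel"
  proof (rule borel_measurable_LIMSEQ_real)
    fix t
    have "(\<lambda>n. t + inverse (Suc n)) \<longlonglongrightarrow> t + 0"
      by (intro tendsto_add tendsto_const LIMSEQ_inverse_real_of_nat)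
    then have "(\<lambda>n. a n t) \<longlonglongrightarrow> t"
      using a by (intro tendsto_sandwich[of "\<lambda>_. t" "\<lambda>n. a n t" _ "\<lambda>n. t + inverse (Suc n)"])
        (auto intro!: always_eventually less_imp_le simp del: of_nat_Suc)
    then have "filterlim (\<lambda>n. a n t) (at_right t) sequentially"
      using a by (auto simp: filterlim_at less_imp_neq[symmetric])
    then show "(\<lambda>n. g (a n t)) \<longlonglongrightarrow> g t"
      by (rule filterlim_compose[OF g])
  next
    fix n
    have "(\<lambda>t::real. \<lfloor>t * Suc n\<rfloor>) \<in> measurable borel (count_space UNIV)"
      by (rule measurable_compose[OF _ measurable_real_floor]) simp
    then show "(\<lambda>t. g (a n t)) \<in> borel_measurable borel"
      unfolding a_def by (rule measurable_compose) simp
  qed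
  then show "(\<lambda>t. x (max 0 t)) \<in> borel_measurable borel" unfolding g_def .
qed

lemma integrable_on_of_bounded_measurable:
  fixes x :: "real \<Rightarrow> real"
  assumes "(\<lambda>t. x (max 0 t)) \<in> borel_measurable borel"
    and "\<And>t. t \<in> {0..T} \<Longrightarrow> \<bar>x t\<bar> \<le> B"
  shows "x integrable_on {0..T}"
proof -
  have "set_integrable lborel {0..T} (\<lambda>t. x (max 0 t))"
    unfolding set_integrable_def
    using assms by (intro integrableI_bounded_set_indicator[where B = B]) (auto simp: emeasure_lborel_Icc_eq)
  then have "(\<lambda>t. x (max 0 t)) integrable_on {0..T}"
    by (rule set_borel_integral_eq_integral)
  then show ?thesis by (rule integrable_eq) auto
qed

lemma indefinite_integral_diff:
  fixes x :: "real \<Rightarrow> real"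
  assumes "x integrable_on {0..t}" "0 \<le> s" "s \<le> t"
  shows "integral {0..t} x - integral {0..s} x = integral {s..t} x" and "x integrable_on {s..t}"
  using Henstock_Kurzweil_Integration.integral_combine[of 0 s t x] assms
  by (auto intro: integrable_subinterval_real)

lemma indefinite_integral_lipschitz:
  fixes x :: "real \<Rightarrow> real"
  assumes "x integrable_on {0..t}" "0 \<le> s" "s \<le> t" "\<And>r. r \<in> {0..t} \<Longrightarrow> \<bar>x r\<bar> \<le> 1"
  shows "\<bar>integral {0..t} x - integral {0..s} x\<bar> \<le> t - s"
proof -
  have "norm (integral {s..t} x) \<le> integral {s..t} (\<lambda>_. 1)"
    using assms indefinite_integral_diff(2)[OF assms(1-3)]
    by (intro integral_norm_bound_integral) auto
  then show ?thesis
    using indefinite_integral_diff(1)[OF assms(1-3)] assms(3) by simp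
qed

lemma continuous_on_of_lipschitz:
  fixes g :: "real \<Rightarrow> real"
  assumes "\<And>s t. 0 \<le> s \<Longrightarrow> s \<le> t \<Longrightarrow> \<bar>g t - g s\<bar> \<le> t - s"
  shows "continuous_on {0..} g"
proof (rule continuous_onI)
  fix t e :: real assume "t \<in> {0..}" "e > 0"
  have "dist (g s) (g t) \<le> dist s t" if "s \<in> {0..}" for s
    using assms[of s t] assms[of t s] that \<open>t \<in> {0..}\<close>
    by (cases "s \<le> t") (auto simp: dist_real_def)
  then show "\<exists>d>0. \<forall>s\<in>{0..}. dist s t < d \<longrightarrow> dist (g s) (g t) \<le> e"
    using \<open>e > 0\<close> by (meson less_imp_le order_trans)
qed

lemma continuous_on_imp_cadlag:
  assumes "continuous_on {0..} x"
  shows "cadlag x"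
  unfolding cadlag_def
proof safe
  fix t :: real assume "t \<ge> 0"
  then have "(x \<longlongrightarrow> x t) (at t within {0..})"
    using assms by (auto simp: continuous_on_def)
  then show "(x \<longlongrightarrow> x t) (at_right t)"
    by (rule tendsto_within_subset) (use \<open>t \<ge> 0\<close> in auto)
next
  fix t :: real assume "t > 0"
  then have "isCont x t"
    using assms by (intro continuous_on_interior[of "{0..}"]) (auto simp: interior_real_atLeast)
  then show "\<exists>l. (x \<longlongrightarrow> l) (at_left t)"
    by (auto simp: isCont_def filterlim_at_split)
qed

text \<open>A Stieltjes measure carried by the zeros of \<open>e\<close> charges \<open>[a, t]\<close>, where \<open>a\<close> is the first time at
  which \<open>v\<close> exceeds \<open>v t - \<eta>\<close>; hence \<open>e\<close> has a zero there.\<close>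

lemma zero_of_stieltjes_complementarity:
  fixes e v :: "real \<Rightarrow> real"
  assumes e: "(\<lambda>s. e (max 0 s)) \<in> borel_measurable borel" "\<And>s. s \<ge> 0 \<Longrightarrow> e s \<ge> 0"
    and v: "mono_on {0..} v" "\<And>t. t \<ge> 0 \<Longrightarrow> (v \<longlongrightarrow> v t) (at_right t)" "v 0 = 0"
    and compl: "(\<integral>\<^sup>+s\<in>{0..}. ennreal (e s) \<partial>interval_measure (\<lambda>s. v (max 0 s))) = 0"
    and t: "t \<ge> 0" and \<eta>: "0 < \<eta>" "\<eta> < v t"
  shows "\<exists>s\<in>{0..t}. v t - \<eta> \<le> v s \<and> e s = 0"
proof (rule ccontr)
  assume no_zero: "\<not> ?thesis"
  define V where "V s = v (max 0 s)" for s
  define \<nu> where "\<nu> = interval_measure V"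
  define c where "c = v t - \<eta>"
  define S where "S = {s\<in>{0..t}. c \<le> V s}"
  define a where "a = Inf S"
  have c: "0 < c" "c < v t" using \<eta> by (auto simp: c_def)
  have mono: "V x \<le> V y" if "x \<le> y" for x y
    unfolding V_def using that by (intro mono_onD[OF v(1)]) auto
  have lim: "(V \<longlongrightarrow> V s) (at_right s)" for s
    unfolding V_def by (rule right_continuous_borel_measurable(2)) (rule v(2))
  then have rc: "continuous (at_right s) V" for s
    by (simp add: continuous_within)
  have em: "emeasure \<nu> {x<..y} = ennreal (V y - V x)" if "x \<le> y" for x y
    unfolding \<nu>_def using emeasure_interval_measure_Ioc[OF that mono rc] by simp
  have sets[simp]: "sets \<nu> = sets borel" by (simp add: \<nu>_def)
  have Vt: "V t = v t" using t by (simp add: V_def)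
  have tS: "t \<in> S" using t c Vt by (auto simp: S_def)
  have bdd: "bdd_below S" by (rule bdd_belowI[of _ 0]) (auto simp: S_def)
  have a0: "0 \<le> a" unfolding a_def using tS by (intro cInf_greatest) (auto simp: S_def)
  have a_t: "a \<le> t" unfolding a_def by (rule cInf_lower[OF tS bdd])
  have above: "c \<le> V s" if as: "a < s" for s
  proof -
    obtain r where "r \<in> S" "r < s" using cInf_lessD[of S s] as tS unfolding a_def by blast
    then show ?thesis using mono[of r s] by (auto simp: S_def)
  qed
  have "eventually (\<lambda>s. a < s) (at_right a)" by (simp add: eventually_at_right_less)
  then have "eventually (\<lambda>s. c \<le> V s) (at_right a)" by eventually_elim (rule above)
  \<comment> \<open>Right-continuity includes the endpoint \<open>a\<close>: the level
    \<open>c\<close> is attained on all of the closed interval from \<open>a\<close> to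
    \<open>t\<close>.\<close>
  then have ca: "c \<le> V a" by (intro tendsto_lowerbound[OF lim]) auto
  have below: "V s \<le> c" if "s < a" for s
  proof (cases "s \<ge> 0")
    case True
    show ?thesis
    proof (rule ccontr)
      assume "\<not> V s \<le> c"
      then have "s \<in> S" using True that a_t by (auto simp: S_def)
      then show False using cInf_lower[OF _ bdd, of s] that by (simp add: a_def)
    qed
  qed (use c v(3) in \<open>simp add: V_def\<close>)
  \<comment> \<open>The level \<open>c\<close> is positive, whereas \<open>V\<close> starts at
    0.\<close>
  have a_pos: "a > 0"
    using ca a0 c v(3) by (cases "a = 0") (auto simp: V_def)
  \<comment> \<open>Exhaustion by half-open intervals that end strictly before \<open>a\<close>. A
    jump of \<open>V\<close> at \<open>a\<close> is thus not counted here; it belongs to the closed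
    interval treated next.\<close>
  have "emeasure \<nu> {0<..<a} \<le> ennreal c"
  proof -
    define A where "A n = {0<..a - a / Suc n}" for n
    have inc: "incseq A"
    proof (rule monoI)
      fix m n :: nat assume "m \<le> n"
      then have "a / Suc n \<le> a / Suc m" using a_pos by (intro divide_left_mono) auto
      then show "A m \<subseteq> A n" by (auto simp: A_def simp del: of_nat_Suc)
    qed
    have "{0<..<a} = (\<Union>n. A n)"
    proof safe
      fix s assume s: "s \<in> {0<..<a}"
      then obtain n where "1 / Suc n < (a - s) / a"
        using nat_approx_posE[of "(a - s) / a"] a_pos by auto
      then have "a / Suc n < a - s" using a_pos by (simp add: field_simps del: of_nat_Suc)
      then show "s \<in> (\<Union>n. A n)" using s by (auto simp: A_def intro!: exI[of _ n])
    next
      fix s n assume "s \<in> A n"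
      moreover have "a / Suc n > 0" using a_pos by simp
      ultimately show "s \<in> {0<..<a}" by (auto simp: A_def simp del: of_nat_Suc)
    qed
    moreover have "range A \<subseteq> sets \<nu>" by (auto simp: A_def)
    ultimately have "emeasure \<nu> {0<..<a} = (SUP n. emeasure \<nu> (A n))"
      using SUP_emeasure_incseq[OF _ inc, of \<nu>] by simp
    also have "\<dots> \<le> ennreal c"
    proof (rule SUP_least)
      fix n :: nat
      have *: "0 \<le> a - a / Suc n" "a - a / Suc n < a"
        using a_pos divide_left_mono[of 1 "real (Suc n)" a] by (auto simp del: of_nat_Suc)
      show "emeasure \<nu> (A n) \<le> ennreal c"
        unfolding A_def em[OF *(1)] using below[OF *(2)] v(3) by (intro ennreal_leI) (simp add: V_def)
    qed
    finally show ?thesis .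
  qed
  \<comment> \<open>Almost every point of the measure on the half-line is a zero of
    \<open>e\<close>, but by assumption \<open>e\<close> has no zero between \<open>a\<close> and
    \<open>t\<close>, where \<open>v\<close> is at least \<open>c\<close>.\<close>
  moreover have "emeasure \<nu> {a..t} = 0"
  proof -
    have "(\<integral>\<^sup>+s. ennreal (e (max 0 s)) * indicator {0..} s \<partial>\<nu>) = (\<integral>\<^sup>+s\<in>{0..}. ennreal (e s) \<partial>\<nu>)"
      by (intro nn_integral_cong) (auto simp: indicator_def)
    also have "\<dots> = 0" using compl by (simp add: \<nu>_def V_def[abs_def])
    finally have "AE s in \<nu>. ennreal (e (max 0 s)) * indicator {0..} s = 0"
      using e(1) by (subst (asm) nn_integral_0_iff_AE) (auto simp: \<nu>_def)
    then have "AE s in \<nu>. s \<notin> {a..t}"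
    proof eventually_elim
      case (elim s)
      show ?case
      proof
        assume s: "s \<in> {a..t}"
        then have "s \<ge> 0" using a0 by auto
        then have "e s = 0" using elim e(2)[of s] by (auto simp: indicator_def)
        moreover have "c \<le> v s" using ca mono[of a s] s \<open>s \<ge> 0\<close> by (simp add: V_def)
        ultimately show False using no_zero s \<open>s \<ge> 0\<close> by (auto simp: c_def)
      qed
    qed
    then show ?thesis by (subst (asm) AE_iff_measurable[of "{a..t}"]) (auto simp: \<nu>_def)
  qed
  moreover have "emeasure \<nu> {0<..t} \<le> emeasure \<nu> {0<..<a} + emeasure \<nu> {a..t}"
  proof -
    have "{0<..t} = {0<..<a} \<union> {a..t}" using a_pos a_t by auto
    then show ?thesis by (simp add: emeasure_subadditive)
  qed
  moreover have "emeasure \<nu> {0<..t} = ennreal (v t)"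
    using em[OF t] v(3) Vt by (simp add: V_def)
  ultimately have "ennreal (v t) \<le> ennreal c" by simp
  then show False using c by simp
qed

lemma cadlag_rightD:
  "cadlag x \<Longrightarrow> t \<ge> 0 \<Longrightarrow> (x \<longlongrightarrow> x t) (at_right t)"
  by (simp add: cadlag_def)

section \<open>Exact solutions as competitors with error zero\<close>

context fluid_data
begin

text \<open>Makes the stability estimate applicable to exact solutions, for uniqueness as well as
  for convergence. No continuity of \<open>u\<close> is assumed: right-continuity suffices for
  integrability and for extracting zeros from the Stieltjes condition.\<close>

lemma fluid_solution_imp_perturbed_fluid:
  assumes sol: "fluid_solution lam \<mu> P Q e0 f0 e f u" and "T \<ge> 0"
  shows "perturbed_fluid T 0 e0 f0 e f u"
proof -
  have cad: "cadlag (\<lambda>t. (e t, f t, u t))"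
    and states: "\<And>t. t \<ge> 0 \<Longrightarrow> (e t, f t) \<in> fluid_states"
    and u0: "u 0 = 0" and mono: "\<And>i. mono_on {0..} (\<lambda>t. u t $ i)"
    and compl: "\<And>i. (\<integral>\<^sup>+s\<in>{0..}. ennreal (e s $ i $ i) \<partial>interval_measure (\<lambda>s. u (max 0 s) $ i)) = 0"
    using sol by (auto simp: fluid_solution_def)
  have rc: "((\<lambda>t. e t $ i $ j) \<longlongrightarrow> e t $ i $ j) (at_right t)"
    "((\<lambda>t. f t $ i $ j) \<longlongrightarrow> f t $ i $ j) (at_right t)"
    "((\<lambda>t. u t $ i) \<longlongrightarrow> u t $ i) (at_right t)" if "t \<ge> 0" for t i j
    using tendsto_fst[OF cadlag_rightD[OF cad that]] tendsto_snd[OF cadlag_rightD[OF cad that]]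
    by (auto dest: tendsto_fst tendsto_snd intro!: tendsto_vec_nth)
  have bounds: "e t $ i $ j \<in> {0..1}" "f t $ i $ j \<in> {0..1}" if "t \<ge> 0" for t i j
    using states[OF that] by (auto simp: fluid_states_def)
  have int: "(\<lambda>s. e s $ i $ j) integrable_on {0..T}" "(\<lambda>s. f s $ i $ j) integrable_on {0..T}" for i j
    using bounds rc by (auto intro!: integrable_on_of_bounded_measurable[where B = 1]
      right_continuous_borel_measurable(1))
  have zero: "\<exists>s\<in>{0..t}. u t $ i - \<eta> \<le> u s $ i \<and> e s $ i $ i = 0"
    if "t \<ge> 0" "0 < \<eta>" "\<eta> < u t $ i" for t i \<eta>
  proof (rule zero_of_stieltjes_complementarity[where v = "\<lambda>t. u t $ i" and e = "\<lambda>t. e t $ i $ i"])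
    show "(\<lambda>s. e (max 0 s) $ i $ i) \<in> borel_measurable borel"
      by (rule right_continuous_borel_measurable(1)) (rule rc)
  qed (use that bounds mono rc u0 compl in auto)
  have eqs: "\<And>t i j. t \<ge> 0 \<Longrightarrow> f t $ i $ j = f_drift f0 f u t i j"
    "\<And>t i j. t \<ge> 0 \<Longrightarrow> i \<noteq> j \<Longrightarrow> e t $ i $ j = transit_drift e0 e f t i j"
    "\<And>t i. t \<ge> 0 \<Longrightarrow> e t $ i $ i = station_drift e0 e f u t i"
    using sol unfolding fluid_solution_def f_drift_def transit_drift_def station_drift_def by simp_all
  show ?thesis
  proof (rule perturbed_fluidI)
    fix t i j assume t: "t \<in> {0..T}"
    show "0 \<le> u t $ i" using mono_onD[OF mono, of 0 t i] t u0 by simp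
    show "\<bar>f t $ i $ j - f_drift f0 f u t i j\<bar> \<le> 0" using eqs(1)[of t i j] t by simp
    show "\<bar>e t $ i $ j - transit_drift e0 e f t i j\<bar> \<le> 0" if "i \<noteq> j"
      using eqs(2)[of t i j] that t by simp
    show "\<bar>e t $ i $ i - station_drift e0 e f u t i\<bar> \<le> 0" using eqs(3)[of t i] t by simp
    show "e t $ i $ j \<in> {0..1}" "f t $ i $ j \<in> {0..1}" using bounds[of t i j] t by simp_all
    show "\<exists>s\<in>{0..t}. u t $ i - \<eta> \<le> u s $ i \<and> e s $ i $ i = 0" if "0 < \<eta>" "\<eta> < u t $ i" for \<eta>
      using zero[of t \<eta> i] that t by simp
  next
    fix i
    show "mono_on {0..T} (\<lambda>t. u t $ i)" by (rule mono_on_subset[OF mono]) simp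
  qed (rule int)+
qed

end

section \<open>Scaled network paths\<close>

definition zero_time :: "(real \<Rightarrow> real) \<Rightarrow> real \<Rightarrow> real" where
  "zero_time z t = integral {0..t} (\<lambda>s. if z s = 0 then 1 else 0)"

lemma zero_time_integrable:
  fixes z :: "real \<Rightarrow> real"
  assumes "\<And>t. t \<ge> 0 \<Longrightarrow> (z \<longlongrightarrow> z t) (at_right t)"
  shows "(\<lambda>s. if z s = 0 then 1 else 0 :: real) integrable_on {0..t}"
proof (rule integrable_on_of_bounded_measurable)
  have [measurable]: "(\<lambda>t. z (max 0 t)) \<in> borel_measurable borel"
    by (rule right_continuous_borel_measurable(1)) (rule assms)
  show "(\<lambda>t. if z (max 0 t) = 0 then 1 else 0 :: real) \<in> borel_measurable borel"
    by measurable
  show "\<bar>if z s = 0 then 1 else 0 :: real\<bar> \<le> 1" for s by simp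
qed

lemma zero_time_increment:
  assumes z: "\<And>t. t \<ge> 0 \<Longrightarrow> (z \<longlongrightarrow> z t) (at_right t)" and st: "0 \<le> s" "s \<le> t"
  shows "zero_time z s \<le> zero_time z t" "\<bar>zero_time z t - zero_time z s\<bar> \<le> t - s"
    and "(\<And>r. r \<in> {s..t} \<Longrightarrow> z r \<noteq> 0) \<Longrightarrow> zero_time z t = zero_time z s"
proof -
  note int = zero_time_integrable[of z, OF z, of t]
  have eq: "zero_time z t - zero_time z s = integral {s..t} (\<lambda>s. if z s = 0 then 1 else 0)"
    unfolding zero_time_def by (rule indefinite_integral_diff(1)[OF int st])
  have "0 \<le> integral {s..t} (\<lambda>s. if z s = 0 then 1 else 0 :: real)"
    by (intro integral_nonneg indefinite_integral_diff(2)[OF int st]) auto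
  then show "zero_time z s \<le> zero_time z t" using eq by simp
  show "\<bar>zero_time z t - zero_time z s\<bar> \<le> t - s"
    unfolding zero_time_def by (rule indefinite_integral_lipschitz[OF int st]) auto
  assume "\<And>r. r \<in> {s..t} \<Longrightarrow> z r \<noteq> 0"
  then have "integral {s..t} (\<lambda>s. if z s = 0 then 1 else 0 :: real) = integral {s..t} (\<lambda>s. 0)"
    by (intro integral_cong) auto
  then show "zero_time z t = zero_time z s" using eq by simp
qed

lemma zero_time_zero [simp]: "zero_time z 0 = 0"
  by (simp add: zero_time_def)

text \<open>By continuity the level reduced by \<eta> is attained at some \<open>a\<close>; the idle
  time still grows after \<open>a\<close>, so \<open>z\<close> vanishes somewhere in between. The
  slack is genuine: \<open>z\<close> may leave 0 by a jump just when the idle time stops growing,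
  and then no zero lies at the full level.\<close>

lemma zero_time_complementarity:
  assumes z: "\<And>t. t \<ge> 0 \<Longrightarrow> (z \<longlongrightarrow> z t) (at_right t)"
    and t: "t \<ge> 0" and \<eta>: "0 < \<eta>" "\<eta> < zero_time z t"
  shows "\<exists>s\<in>{0..t}. zero_time z t - \<eta> \<le> zero_time z s \<and> z s = 0"
proof -
  have "continuous_on {0..} (zero_time z)"
    by (rule continuous_on_of_lipschitz) (rule zero_time_increment(2)[OF z])
  then have "continuous_on {0..t} (zero_time z)"
    by (rule continuous_on_subset) auto
  then obtain a where a: "0 \<le> a" "a \<le> t" "zero_time z a = zero_time z t - \<eta>"
    using IVT'[of "zero_time z" 0 "zero_time z t - \<eta>" t] t \<eta> by auto
  have "\<exists>s\<in>{a..t}. z s = 0"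
    using zero_time_increment(3)[OF z a(1,2)] a(3) \<eta>(1) by force
  then obtain s where s: "s \<in> {a..t}" "z s = 0" by blast
  then have "zero_time z a \<le> zero_time z s"
    using a by (intro zero_time_increment(1)[OF z]) auto
  then show ?thesis using s a by auto
qed

lemma idle_time_nth: "idle_time E t $ i = zero_time (\<lambda>s. E s $ i $ i) t"
  by (simp add: idle_time_def zero_time_def)

text \<open>Each routed item has exactly one destination; this is the routing part of the
  conservation of the total.\<close>

lemma sum_routed:
  fixes r :: "nat \<Rightarrow> 'r::finite"
  shows "(\<Sum>j\<in>UNIV. real (routed r j n)) = real n"
proof -
  have "(\<Sum>j\<in>UNIV. sum (\<lambda>_. 1 :: real) {m \<in> {1..n}. r m = j}) = sum (\<lambda>_. 1) {1..n}"
    by (rule sum.group) auto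
  then show ?thesis by (simp add: routed_def)
qed

text \<open>Half of \<epsilon> pays for the slope on the whole range \<open>[0, N K]\<close>, the
  other half for the constant \<open>C\<close> once \<open>N\<close> is large.\<close>

lemma sublinear_on_eventually_le:
  assumes g: "sublinear_on {0..} (\<lambda>s. s) g" and "K \<ge> 0" "\<epsilon> > 0"
  shows "\<forall>\<^sub>F N in sequentially. \<forall>s\<in>{0..real N * K}. \<bar>g s\<bar> \<le> real N * \<epsilon>"
proof -
  \<comment> \<open>The summand 1 keeps the denominator positive when \<open>K = 0\<close>.\<close>
  define \<eta> where "\<eta> = \<epsilon> / (2 * (K + 1))"
  have \<eta>: "\<eta> > 0" "\<eta> * K \<le> \<epsilon> / 2" using assms by (auto simp: \<eta>_def field_simps)
  obtain C where C: "C \<ge> 0" "\<And>s. s \<in> {0..} \<Longrightarrow> \<bar>g s\<bar> \<le> \<eta> * s + C"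
    using sublinear_onE[OF g \<eta>(1)] by metis
  have "\<forall>\<^sub>F N in sequentially. real N \<ge> C / (\<epsilon> / 2)"
    using filterlim_real_sequentially by (simp add: filterlim_at_top)
  then show ?thesis
  proof eventually_elim
    fix N assume "real N \<ge> C / (\<epsilon> / 2)"
    then have N: "C \<le> real N * (\<epsilon> / 2)" using \<open>\<epsilon> > 0\<close> by (simp add: field_simps)
    show "\<forall>s\<in>{0..real N * K}. \<bar>g s\<bar> \<le> real N * \<epsilon>"
    proof
      fix s assume s: "s \<in> {0..real N * K}"
      have "\<bar>g s\<bar> \<le> \<eta> * s + C" using C(2) s by simp
      also have "\<eta> * s \<le> \<eta> * (real N * K)" using s \<eta> by (intro mult_left_mono) auto
      also have "\<dots> = real N * (\<eta> * K)" by simp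
      also have "\<dots> \<le> real N * (\<epsilon> / 2)" using \<eta> by (intro mult_left_mono) auto
      finally show "\<bar>g s\<bar> \<le> real N * \<epsilon>" using N by simp
    qed
  qed
qed

section \<open>A single sample path of the network: conservation, idle time and drift errors\<close>

locale network_realisation = fluid_data lam \<mu> P Q
  for lam :: "real^'r::finite" and \<mu> P Q :: "real^'r^'r" +
  fixes N :: nat and SE SF :: "'r \<Rightarrow> 'r \<Rightarrow> real \<Rightarrow> nat"
    and \<phi> :: "'r \<Rightarrow> nat \<Rightarrow> 'r" and \<psi> :: "'r \<Rightarrow> 'r \<Rightarrow> nat \<Rightarrow> 'r"
    and E0 F0 :: "real^'r^'r" and E F :: "real \<Rightarrow> real^'r^'r"
  assumes N_pos: "N \<ge> 1" and init: "initial_state N E0 F0"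
    and path: "network_path lam \<mu> N SE SF \<phi> \<psi> E0 F0 E F"
begin

lemma right_continuous:
  assumes "t \<ge> 0"
  shows "((\<lambda>t. E t $ i $ j) \<longlongrightarrow> E t $ i $ j) (at_right t)"
    and "((\<lambda>t. F t $ i $ j) \<longlongrightarrow> F t $ i $ j) (at_right t)"
proof -
  have cad: "cadlag (\<lambda>t. (E t, F t))" using path by (simp add: network_path_def)
  show "((\<lambda>t. E t $ i $ j) \<longlongrightarrow> E t $ i $ j) (at_right t)"
    and "((\<lambda>t. F t $ i $ j) \<longlongrightarrow> F t $ i $ j) (at_right t)"
    using tendsto_fst[OF cadlag_rightD[OF cad assms]] tendsto_snd[OF cadlag_rightD[OF cad assms]]
    by (auto intro!: tendsto_vec_nth)
qed

lemma nonneg: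
  assumes "t \<ge> 0"
  shows "E t $ i $ j \<ge> 0" "F t $ i $ j \<ge> 0"
proof -
  have "E t $ i $ j \<in> \<nat>" "F t $ i $ j \<in> \<nat>"
    using path assms unfolding network_path_def by meson+
  then show "E t $ i $ j \<ge> 0" "F t $ i $ j \<ge> 0" by (auto elim!: Nats_cases)
qed

lemma F_eq:
  assumes "t \<ge> 0"
  shows "F t $ i $ j = F0 $ i $ j - real (SF i j (\<mu> $ i $ j * integral {0..t} (\<lambda>s. F s $ i $ j)))
        + real (routed (\<phi> i) j (SE i i (real N * lam $ i * busy_time E i t)))"
  using path assms unfolding network_path_def by meson

lemma E_offdiag_eq:
  assumes "t \<ge> 0" "i \<noteq> j"
  shows "E t $ i $ j = E0 $ i $ j - real (SE i j (\<mu> $ i $ j * integral {0..t} (\<lambda>s. E s $ i $ j)))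
        + (\<Sum>k\<in>UNIV. real (routed (\<psi> k i) j (SF k i (\<mu> $ k $ i * integral {0..t} (\<lambda>s. F s $ k $ i)))))"
  using path assms unfolding network_path_def by meson

lemma E_diag_eq:
  assumes "t \<ge> 0"
  shows "E t $ i $ i = E0 $ i $ i - real (SE i i (real N * lam $ i * busy_time E i t))
        + (\<Sum>j\<in>UNIV - {i}. real (SE j i (\<mu> $ j $ i * integral {0..t} (\<lambda>s. E s $ j $ i))))
        + (\<Sum>j\<in>UNIV. real (routed (\<psi> j i) i (SF j i (\<mu> $ j $ i * integral {0..t} (\<lambda>s. F s $ j $ i)))))"
  using path assms unfolding network_path_def by meson

text \<open>Every departure is an arrival elsewhere: completions at a station enter \<open>F\<close>
  through \<phi>, transits from \<open>i\<close> to \<open>j\<close> enter the diagonal entry of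
  \<open>j\<close>, and departures from \<open>F\<close> enter \<open>E\<close> through \<psi>.
  Summed over all entries, the counts cancel.\<close>

lemma total:
  assumes t: "t \<ge> 0"
  shows "(\<Sum>i\<in>UNIV. \<Sum>j\<in>UNIV. E t $ i $ j + F t $ i $ j) = real N"
proof -
  define sf where "sf i j = SF i j (\<mu> $ i $ j * integral {0..t} (\<lambda>s. F s $ i $ j))" for i j
  define b where "b i = SE i i (real N * lam $ i * busy_time E i t)" for i
  \<comment> \<open>Zero on the diagonal, so that sums over \<open>UNIV - {i}\<close> become full
    sums and the transit terms cancel by exchanging the order of summation.\<close>
  define S where "S i j = (if i = j then 0 else real (SE i j (\<mu> $ i $ j * integral {0..t} (\<lambda>s. E s $ i $ j))))" for i j
  have F: "F t $ i $ j = F0 $ i $ j - real (sf i j) + real (routed (\<phi> i) j (b i))" for i j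
    unfolding sf_def b_def by (rule F_eq[OF t])
  have S_sum: "(\<Sum>j\<in>UNIV - {i}. real (SE j i (\<mu> $ j $ i * integral {0..t} (\<lambda>s. E s $ j $ i)))) = (\<Sum>k\<in>UNIV. S k i)" for i
    by (rule sum.mono_neutral_cong_left) (auto simp: S_def)
  have E: "E t $ i $ j = E0 $ i $ j - (if i = j then real (b i) else 0) - S i j
      + (if i = j then \<Sum>k\<in>UNIV. S k i else 0) + (\<Sum>k\<in>UNIV. real (routed (\<psi> k i) j (sf k i)))" for i j
  proof (cases "i = j")
    case True
    then show ?thesis
      using E_diag_eq[OF t, of i] unfolding S_sum sf_def[symmetric] b_def[symmetric] by (simp add: S_def)
  next
    case False
    then show ?thesis
      using E_offdiag_eq[OF t False] unfolding sf_def[symmetric] by (simp add: S_def)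
  qed
  have Fsum: "(\<Sum>i\<in>UNIV. \<Sum>j\<in>UNIV. F t $ i $ j)
      = (\<Sum>i\<in>UNIV. \<Sum>j\<in>UNIV. F0 $ i $ j) - (\<Sum>i\<in>UNIV. \<Sum>j\<in>UNIV. real (sf i j)) + (\<Sum>i\<in>UNIV. real (b i))"
    unfolding F by (simp add: sum.distrib sum_subtractf sum_routed)
  have "(\<Sum>i\<in>UNIV. \<Sum>j\<in>UNIV. \<Sum>k\<in>UNIV. real (routed (\<psi> k i) j (sf k i))) = (\<Sum>i\<in>UNIV. \<Sum>k\<in>UNIV. \<Sum>j\<in>UNIV. real (routed (\<psi> k i) j (sf k i)))"
    by (rule sum.cong[OF refl], rule sum.swap)
  also have "\<dots> = (\<Sum>i\<in>UNIV. \<Sum>k\<in>UNIV. real (sf k i))" by (simp add: sum_routed)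
  also have "\<dots> = (\<Sum>i\<in>UNIV. \<Sum>j\<in>UNIV. real (sf i j))" by (rule sum.swap)
  finally have R: "(\<Sum>i\<in>UNIV. \<Sum>j\<in>UNIV. \<Sum>k\<in>UNIV. real (routed (\<psi> k i) j (sf k i))) = (\<Sum>i\<in>UNIV. \<Sum>j\<in>UNIV. real (sf i j))" .
  have "(\<Sum>i\<in>UNIV. \<Sum>k\<in>UNIV. S k i) = (\<Sum>i\<in>UNIV. \<Sum>j\<in>UNIV. S i j)" by (rule sum.swap)
  then have Esum: "(\<Sum>i\<in>UNIV. \<Sum>j\<in>UNIV. E t $ i $ j)
      = (\<Sum>i\<in>UNIV. \<Sum>j\<in>UNIV. E0 $ i $ j) - (\<Sum>i\<in>UNIV. real (b i)) + (\<Sum>i\<in>UNIV. \<Sum>j\<in>UNIV. real (sf i j))"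
    unfolding E by (simp add: sum.distrib sum_subtractf R)
  have "(\<Sum>i\<in>UNIV. \<Sum>j\<in>UNIV. E0 $ i $ j) + (\<Sum>i\<in>UNIV. \<Sum>j\<in>UNIV. F0 $ i $ j) = real N"
    using init by (simp add: initial_state_def sum.distrib)
  then show ?thesis using Esum Fsum by (simp add: sum.distrib)
qed

definition e :: "real \<Rightarrow> real^'r^'r" where "e t = (1 / real N) *\<^sub>R E t"
definition f :: "real \<Rightarrow> real^'r^'r" where "f t = (1 / real N) *\<^sub>R F t"

lemma scaled_nth: "e t $ i $ j = E t $ i $ j / real N" "f t $ i $ j = F t $ i $ j / real N"
  by (simp_all add: e_def f_def)

lemma scaled_fluid_states:
  assumes t: "t \<ge> 0"
  shows "(e t, f t) \<in> fluid_states"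
proof -
  have "(\<Sum>i\<in>UNIV. \<Sum>j\<in>UNIV. e t $ i $ j + f t $ i $ j) = (\<Sum>i\<in>UNIV. \<Sum>j\<in>UNIV. E t $ i $ j + F t $ i $ j) / real N"
    by (simp add: scaled_nth add_divide_distrib[symmetric] sum_divide_distrib[symmetric])
  then have sum1: "(\<Sum>i\<in>UNIV. \<Sum>j\<in>UNIV. e t $ i $ j + f t $ i $ j) = 1"
    using total[OF t] N_pos by simp
  have nn: "e t $ i $ j \<ge> 0" "f t $ i $ j \<ge> 0" for i j
    using nonneg[OF t] by (simp_all add: scaled_nth)
  have "e t $ i $ j + f t $ i $ j \<le> 1" for i j
  proof -
    have "e t $ i $ j + f t $ i $ j \<le> (\<Sum>j\<in>UNIV. e t $ i $ j + f t $ i $ j)"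
      by (rule member_le_sum[of j UNIV "\<lambda>j. e t $ i $ j + f t $ i $ j"]) (auto simp: nn)
    also have "\<dots> \<le> (\<Sum>i\<in>UNIV. \<Sum>j\<in>UNIV. e t $ i $ j + f t $ i $ j)"
      by (rule member_le_sum[of i UNIV "\<lambda>i. \<Sum>j\<in>UNIV. e t $ i $ j + f t $ i $ j"])
         (auto simp: nn intro!: sum_nonneg add_nonneg_nonneg)
    finally show ?thesis using sum1 by simp
  qed
  then have "e t $ i $ j \<le> 1" "f t $ i $ j \<le> 1" for i j
    using nn[of i j] by (smt (verit))+
  then show ?thesis using nn sum1 by (simp add: fluid_states_def)
qed

lemma scaled_bounds:
  assumes "t \<ge> 0" shows "e t $ i $ j \<in> {0..1}" "f t $ i $ j \<in> {0..1}"
  using scaled_fluid_states[OF assms] by (simp_all add: fluid_states_def)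

lemma scaled_integrable:
  "(\<lambda>s. e s $ i $ j) integrable_on {0..T}" "(\<lambda>s. f s $ i $ j) integrable_on {0..T}"
proof -
  have "((\<lambda>t. e t $ i $ j) \<longlongrightarrow> e t $ i $ j) (at_right t)"
    "((\<lambda>t. f t $ i $ j) \<longlongrightarrow> f t $ i $ j) (at_right t)" if "t \<ge> 0" for t
    unfolding scaled_nth using N_pos by (auto intro!: tendsto_divide right_continuous[OF that])
  moreover have "\<bar>e t $ i $ j\<bar> \<le> 1" "\<bar>f t $ i $ j\<bar> \<le> 1" if "t \<in> {0..T}" for t
    using scaled_bounds[of t i j] that by auto
  ultimately show "(\<lambda>s. e s $ i $ j) integrable_on {0..T}" "(\<lambda>s. f s $ i $ j) integrable_on {0..T}"
    by (intro integrable_on_of_bounded_measurable[where B = 1] right_continuous_borel_measurable(1); simp)+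
qed

lemma integral_unscaled:
  "integral {0..t} (\<lambda>s. E s $ i $ j) = real N * integral {0..t} (\<lambda>s. e s $ i $ j)"
  "integral {0..t} (\<lambda>s. F s $ i $ j) = real N * integral {0..t} (\<lambda>s. f s $ i $ j)"
  using N_pos by (simp_all add: scaled_nth)

lemma integral_scaled_bounds:
  assumes "t \<ge> 0"
  shows "integral {0..t} (\<lambda>s. e s $ i $ j) \<in> {0..t}" "integral {0..t} (\<lambda>s. f s $ i $ j) \<in> {0..t}"
proof -
  have "integral {0..t} (\<lambda>s. x s) \<in> {0..t}"
    if "x integrable_on {0..t}" "\<And>s. s \<ge> 0 \<Longrightarrow> x s \<in> {0..1}" for x :: "real \<Rightarrow> real"
  proof -
    have "0 \<le> integral {0..t} x" using that by (intro integral_nonneg) auto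
    moreover have "integral {0..t} x \<le> integral {0..t} (\<lambda>_. 1)" using that by (intro integral_le) auto
    ultimately show ?thesis using assms by simp
  qed
  then show "integral {0..t} (\<lambda>s. e s $ i $ j) \<in> {0..t}" "integral {0..t} (\<lambda>s. f s $ i $ j) \<in> {0..t}"
    using scaled_integrable scaled_bounds by blast+
qed

lemma idle_time_increment:
  assumes "0 \<le> s" "s \<le> t"
  shows "idle_time E s $ i \<le> idle_time E t $ i" "\<bar>idle_time E t $ i - idle_time E s $ i\<bar> \<le> t - s"
    and "(\<And>r. r \<in> {s..t} \<Longrightarrow> e r $ i $ i \<noteq> 0) \<Longrightarrow> idle_time E t $ i = idle_time E s $ i"
  unfolding idle_time_nth using zero_time_increment[OF right_continuous(1) assms, of i i] N_pos
  by (auto simp: scaled_nth)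

lemma busy_time_eq:
  assumes "t \<ge> 0"
  shows "busy_time E i t = t - idle_time E t $ i"
proof -
  have int: "(\<lambda>s. if E s $ i $ i = 0 then 1 else 0 :: real) integrable_on {0..t}"
    by (rule zero_time_integrable) (rule right_continuous(1))
  have "busy_time E i t = integral {0..t} (\<lambda>s. 1 - (if E s $ i $ i = 0 then 1 else 0))"
    unfolding busy_time_def using nonneg(1)
    by (intro integral_cong) (auto simp: order.strict_iff_order)
  also have "\<dots> = integral {0..t} (\<lambda>_. 1) - integral {0..t} (\<lambda>s. if E s $ i $ i = 0 then 1 else 0)"
    by (rule integral_diff) (auto simp: int)
  finally show ?thesis using assms by (simp add: idle_time_def)
qed

text \<open>After division by \<open>N\<close> each counting term is its mean, which reproduces the
  drift, plus a centred error of at most \<epsilon>. The constant counts errors: three for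
  \<open>f\<close> (initial value, clock, routing); for the diagonal of \<open>e\<close>, the worst
  case in general, the initial value, the service clock, and at most \<open>CARD('r)\<close> errors
  each from transits and from routing.\<close>

lemma scaled_perturbed_fluid:
  assumes T: "T \<ge> 0" and \<epsilon>: "\<epsilon> \<ge> 0"
    and K: "\<And>i. T * lam $ i \<le> K" "\<And>i j. T * \<mu> $ i $ j \<le> K"
    and SE: "\<And>i j s. s \<in> {0..real N * K} \<Longrightarrow> \<bar>real (SE i j s) - s\<bar> \<le> real N * \<epsilon>"
    and SF: "\<And>i j s. s \<in> {0..real N * K} \<Longrightarrow> \<bar>real (SF i j s) - s\<bar> \<le> real N * \<epsilon>"
    and \<phi>: "\<And>i j s. s \<in> {0..real N * K} \<Longrightarrow> \<bar>real (routed (\<phi> i) j (SE i i s)) - P $ i $ j * s\<bar> \<le> real N * \<epsilon>"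
    and \<psi>: "\<And>k i j s. s \<in> {0..real N * K} \<Longrightarrow> \<bar>real (routed (\<psi> k i) j (SF k i s)) - Q $ i $ j * s\<bar> \<le> real N * \<epsilon>"
    and init_E: "\<And>i j. \<bar>E0 $ i $ j / real N - e0 $ i $ j\<bar> \<le> \<epsilon>"
    and init_F: "\<And>i j. \<bar>F0 $ i $ j / real N - f0 $ i $ j\<bar> \<le> \<epsilon>"
  shows "perturbed_fluid T ((3 + 2 * real CARD('r)) * \<epsilon>) e0 f0 e f (idle_time E)"
proof -
  let ?u = "idle_time E"
  have u: "0 \<le> ?u t $ i" "?u t $ i \<le> t" if "t \<ge> 0" for t i
    using idle_time_increment(1,2)[of 0 t i] that by (auto simp: idle_time_nth)
  \<comment> \<open>\<open>A\<close>, \<open>B\<close> and \<open>C\<close> are the clock arguments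
    divided by \<open>N\<close>: departures from \<open>F\<close>, transits in \<open>E\<close>, and
    service at the stations.\<close>
  define A where "A t i j = \<mu> $ i $ j * integral {0..t} (\<lambda>s. f s $ i $ j)" for t i j
  define B where "B t i j = \<mu> $ i $ j * integral {0..t} (\<lambda>s. e s $ i $ j)" for t i j
  define C where "C t i = lam $ i * (t - ?u t $ i)" for t i
  have range: "real N * A t i j \<in> {0..real N * K}" "real N * B t i j \<in> {0..real N * K}"
      "real N * C t i \<in> {0..real N * K}" if t: "t \<in> {0..T}" for t i j
  proof -
    have *: "real N * (c * x) \<in> {0..real N * K}" if "x \<in> {0..t}" "T * c \<le> K" "c > 0" for c x
    proof -
      have "x * c \<le> T * c" using that t by (intro mult_right_mono) auto
      then have "c * x \<le> K" using that(2) by (subst mult.commute) (rule order_trans)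
      then have "real N * (c * x) \<le> real N * K" using that by (intro mult_left_mono) auto
      then show ?thesis using that by simp
    qed
    show "real N * A t i j \<in> {0..real N * K}" "real N * B t i j \<in> {0..real N * K}"
      "real N * C t i \<in> {0..real N * K}"
      unfolding A_def B_def C_def
      using t u[of t i] by (intro * integral_scaled_bounds K lam_pos \<mu>_pos; simp)+
  qed
  have SE': "\<bar>(real (SE i j s) - s) / real N\<bar> \<le> \<epsilon>"
    and SF': "\<bar>(real (SF i j s) - s) / real N\<bar> \<le> \<epsilon>"
    and \<phi>': "\<bar>(real (routed (\<phi> i) j (SE i i s)) - P $ i $ j * s) / real N\<bar> \<le> \<epsilon>"
    and \<psi>': "\<bar>(real (routed (\<psi> k i) j (SF k i s)) - Q $ i $ j * s) / real N\<bar> \<le> \<epsilon>"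
    if "s \<in> {0..real N * K}" for i j k s
    using SE[OF that, of i j] SF[OF that, of i j] \<phi>[OF that, of i j] \<psi>[OF that, of k i j] N_pos
    by (simp_all add: abs_divide divide_le_eq mult.commute)
  have sum_le: "\<bar>\<Sum>k\<in>X. x k\<bar> \<le> real CARD('r) * \<epsilon>" if "\<And>k. \<bar>x k\<bar> \<le> \<epsilon>" for X :: "'r set" and x
  proof -
    have "\<bar>\<Sum>k\<in>X. x k\<bar> \<le> (\<Sum>k\<in>X. \<bar>x k\<bar>)" by (rule sum_abs)
    also have "\<dots> \<le> (\<Sum>k\<in>UNIV. \<bar>x k\<bar>)" by (rule sum_mono2) auto
    also have "\<dots> \<le> (\<Sum>k\<in>(UNIV::'r set). \<epsilon>)" using that by (intro sum_mono) auto
    finally show ?thesis by simp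
  qed
  have card: "real CARD('r) * \<epsilon> \<ge> 0" using \<epsilon> by simp
  have bound: "(3 + 2 * real CARD('r)) * \<epsilon> = 3 * \<epsilon> + 2 * (real CARD('r) * \<epsilon>)"
    by (simp add: algebra_simps)
  have N0: "real N \<noteq> 0" using N_pos by simp
  show ?thesis
  proof (rule perturbed_fluidI)
    fix t i j assume t: "t \<in> {0..T}"
    then have t0: "t \<ge> 0" by simp
    show "e t $ i $ j \<in> {0..1}" "f t $ i $ j \<in> {0..1}" by (rule scaled_bounds[OF t0])+
    show "0 \<le> ?u t $ i" by (rule u(1)[OF t0])
    show "\<exists>s\<in>{0..t}. ?u t $ i - \<eta> \<le> ?u s $ i \<and> e s $ i $ i = 0" if "0 < \<eta>" "\<eta> < ?u t $ i" for \<eta>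
      using zero_time_complementarity[OF right_continuous(1) t0 that[unfolded idle_time_nth]] N0
      by (auto simp: idle_time_nth scaled_nth)
    have busy: "real N * lam $ i * busy_time E i t = real N * C t i" for i
      by (simp add: busy_time_eq[OF t0] C_def)
    have intF: "\<mu> $ i $ j * integral {0..t} (\<lambda>s. F s $ i $ j) = real N * A t i j"
      and intE: "\<mu> $ i $ j * integral {0..t} (\<lambda>s. E s $ i $ j) = real N * B t i j" for i j
      by (simp_all add: integral_unscaled A_def B_def)
    have "f t $ i $ j - f_drift f0 f ?u t i j = (F0 $ i $ j / real N - f0 $ i $ j)
        - (real (SF i j (real N * A t i j)) - real N * A t i j) / real N
        + (real (routed (\<phi> i) j (SE i i (real N * C t i))) - P $ i $ j * (real N * C t i)) / real N"
    proof -
      have "f_drift f0 f ?u t i j = f0 $ i $ j + P $ i $ j * C t i - A t i j"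
        by (simp add: f_drift_def A_def C_def)
      moreover have "f t $ i $ j = F0 $ i $ j / real N - real (SF i j (real N * A t i j)) / real N
          + real (routed (\<phi> i) j (SE i i (real N * C t i))) / real N"
        unfolding scaled_nth F_eq[OF t0, of i j] intF busy by (simp add: add_divide_distrib diff_divide_distrib)
      ultimately show ?thesis using N0 by (simp add: diff_divide_distrib)
    qed
    then have "\<bar>f t $ i $ j - f_drift f0 f ?u t i j\<bar> \<le> 3 * \<epsilon>"
      using init_F[of i j] SF'[OF range(1)[OF t, of i j], of i j] \<phi>'[OF range(3)[OF t, of i], of i j]
      by argo
    then show "\<bar>f t $ i $ j - f_drift f0 f ?u t i j\<bar> \<le> (3 + 2 * real CARD('r)) * \<epsilon>"
      using card unfolding bound by argo
    \<comment> \<open>The centred routing errors of all streams entering station \<open>i\<close>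
      and routed to \<open>j\<close>; \<open>R_eq\<close> separates the counts from their
      compensator.\<close>
    define R where "R i j = (\<Sum>k\<in>UNIV. (real (routed (\<psi> k i) j (SF k i (real N * A t k i))) - Q $ i $ j * (real N * A t k i)) / real N)" for i j
    have R_eq: "R i j = (\<Sum>k\<in>UNIV. real (routed (\<psi> k i) j (SF k i (real N * A t k i)))) / real N - Q $ i $ j * (\<Sum>k\<in>UNIV. A t k i)" for i j
      unfolding R_def using N0
      by (simp add: diff_divide_distrib sum_subtractf sum_divide_distrib sum_distrib_left)
    have R: "\<bar>R i j\<bar> \<le> real CARD('r) * \<epsilon>" for i j
      unfolding R_def by (rule sum_le) (rule \<psi>'[OF range(1)[OF t]])
    show "\<bar>e t $ i $ j - transit_drift e0 e f t i j\<bar> \<le> (3 + 2 * real CARD('r)) * \<epsilon>" if "i \<noteq> j"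
    proof -
      have "transit_drift e0 e f t i j = e0 $ i $ j - B t i j + Q $ i $ j * (\<Sum>k\<in>UNIV. A t k i)"
        by (simp add: transit_drift_def A_def B_def)
      moreover have "e t $ i $ j = E0 $ i $ j / real N - real (SE i j (real N * B t i j)) / real N
          + (\<Sum>k\<in>UNIV. real (routed (\<psi> k i) j (SF k i (real N * A t k i)))) / real N"
        unfolding scaled_nth E_offdiag_eq[OF t0 that] intF intE by (simp add: add_divide_distrib diff_divide_distrib)
      ultimately have "e t $ i $ j - transit_drift e0 e f t i j = (E0 $ i $ j / real N - e0 $ i $ j)
          - (real (SE i j (real N * B t i j)) - real N * B t i j) / real N + R i j"
        using N0 by (simp add: diff_divide_distrib R_eq)
      then have "\<bar>e t $ i $ j - transit_drift e0 e f t i j\<bar> \<le> 2 * \<epsilon> + real CARD('r) * \<epsilon>"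
        using init_E[of i j] SE'[OF range(2)[OF t, of i j], of i j] R[of i j] by argo
      then show ?thesis using card \<epsilon> unfolding bound by argo
    qed
    \<comment> \<open>The centred clock errors of the transits that end at station
      \<open>i\<close>.\<close>
    define G where "G = (\<Sum>k\<in>UNIV - {i}. (real (SE k i (real N * B t k i)) - real N * B t k i) / real N)"
    have G_eq: "G = (\<Sum>k\<in>UNIV - {i}. real (SE k i (real N * B t k i))) / real N - (\<Sum>k\<in>UNIV - {i}. B t k i)"
      unfolding G_def using N0 by (simp add: diff_divide_distrib sum_subtractf sum_divide_distrib)
    have G: "\<bar>G\<bar> \<le> real CARD('r) * \<epsilon>"
      unfolding G_def by (rule sum_le) (rule SE'[OF range(2)[OF t]])
    have "station_drift e0 e f ?u t i = e0 $ i $ i - C t i + (\<Sum>k\<in>UNIV - {i}. B t k i) + Q $ i $ i * (\<Sum>k\<in>UNIV. A t k i)"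
      by (simp add: station_drift_def A_def B_def C_def)
    moreover have "e t $ i $ i = E0 $ i $ i / real N - real (SE i i (real N * C t i)) / real N
        + (\<Sum>k\<in>UNIV - {i}. real (SE k i (real N * B t k i))) / real N
        + (\<Sum>k\<in>UNIV. real (routed (\<psi> k i) i (SF k i (real N * A t k i)))) / real N"
      unfolding scaled_nth E_diag_eq[OF t0] intF intE busy by (simp add: add_divide_distrib diff_divide_distrib)
    ultimately have "e t $ i $ i - station_drift e0 e f ?u t i = (E0 $ i $ i / real N - e0 $ i $ i)
        - (real (SE i i (real N * C t i)) - real N * C t i) / real N + G + R i i"
      using N0 by (simp add: diff_divide_distrib R_eq G_eq)
    then have "\<bar>e t $ i $ i - station_drift e0 e f ?u t i\<bar> \<le> 2 * \<epsilon> + 2 * (real CARD('r) * \<epsilon>)"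
      using init_E[of i i] SE'[OF range(3)[OF t, of i], of i i] R[of i i] G by linarith
    then show "\<bar>e t $ i $ i - station_drift e0 e f ?u t i\<bar> \<le> (3 + 2 * real CARD('r)) * \<epsilon>"
      using card \<epsilon> unfolding bound by argo
  next
    fix i
    show "mono_on {0..T} (\<lambda>t. ?u t $ i)"
      by (intro mono_onI idle_time_increment(1)) auto
  qed (rule scaled_integrable)+
qed

end

section \<open>The fluid limit\<close>

text \<open>The counterpart, for continuous paths, of
  \<open>zero_of_stieltjes_complementarity\<close>: the set where \<open>e\<close> is nonzero is
  open, hence covered by countably many rational intervals. Constancy of \<open>v\<close> makes each
  of them null, and so their union.\<close>

lemma stieltjes_null_of_flat:
  fixes e v :: "real \<Rightarrow> real"
  assumes e: "continuous_on {0..} e" "\<And>s. s \<ge> 0 \<Longrightarrow> e s \<ge> 0"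
    and v: "mono_on {0..} v" "continuous_on {0..} v"
    and flat: "\<And>a b. 0 \<le> a \<Longrightarrow> a \<le> b \<Longrightarrow> (\<And>s. s \<in> {a..b} \<Longrightarrow> e s \<noteq> 0) \<Longrightarrow> v a = v b"
  shows "(\<integral>\<^sup>+s\<in>{0..}. ennreal (e s) \<partial>interval_measure (\<lambda>s. v (max 0 s))) = 0"
proof -
  define V where "V s = v (max 0 s)" for s
  define z where "z s = e (max 0 s)" for s
  define \<nu> where "\<nu> = interval_measure V"
  have "continuous_on UNIV (\<lambda>s. v (max 0 s))" "continuous_on UNIV (\<lambda>s. e (max 0 s))"
    by (rule continuous_on_compose2[OF v(2)] continuous_on_compose2[OF e(1)]; auto intro!: continuous_intros)+
  then have cV: "continuous_on UNIV V" and cz: "continuous_on UNIV z"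
    by (simp_all add: V_def[abs_def] z_def[abs_def])
  have mono: "V x \<le> V y" if "x \<le> y" for x y
    unfolding V_def using that by (intro mono_onD[OF v(1)]) auto
  have rc: "continuous (at_right s) V" for s
    using cV by (auto simp: continuous_on_eq_continuous_at intro: continuous_at_imp_continuous_at_within)
  \<comment> \<open>The closed interval is free of zeros, which gives constancy of \<open>V\<close>;
    the measure is evaluated on the half-open one, where it is an increment of
    \<open>V\<close>.\<close>
  define \<Q> where "\<Q> = {(p, q). p \<in> \<rat> \<and> q \<in> \<rat> \<and> p \<le> q \<and> (\<forall>s\<in>{p..q}. z s \<noteq> 0)}"
  have count: "countable \<Q>"
    by (rule countable_subset[of _ "\<rat> \<times> \<rat>"]) (auto simp: \<Q>_def countable_rat)
  have null: "{p<..q} \<in> null_sets \<nu>" if "(p, q) \<in> \<Q>" for p q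
  proof -
    have pq: "p \<le> q" "\<And>s. s \<in> {p..q} \<Longrightarrow> z s \<noteq> 0" using that by (auto simp: \<Q>_def)
    have "V p = V q"
    proof -
      \<comment> \<open>Endpoints may be negative, where \<open>z\<close> is frozen at
        \<open>e 0\<close>: for \<open>q < 0\<close> the interval shrinks to 0, and
        \<open>z q\<close> carries the information about \<open>e 0\<close>.\<close>
      have "e s \<noteq> 0" if "s \<in> {max 0 p..max 0 q}" for s
      proof (cases "q \<ge> 0")
        case True
        then show ?thesis using pq(2)[of s] that by (auto simp: z_def max_def split: if_splits)
      next
        case False
        then have "s = 0" using that pq(1) by auto
        then show ?thesis using pq(2)[of q] False pq(1) by (simp add: z_def max_def)
      qed
      then show ?thesis unfolding V_def using pq(1) by (intro flat) auto
    qed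
    then have "emeasure \<nu> {p<..q} = 0"
      unfolding \<nu>_def using emeasure_interval_measure_Ioc[OF pq(1) mono rc] by simp
    then show ?thesis by (auto simp: null_sets_def \<nu>_def)
  qed
  have "(\<Union>(p, q)\<in>\<Q>. {p<..q}) \<in> null_sets \<nu>"
    using null by (intro null_sets_UN' count) auto
  then have "AE s in \<nu>. s \<notin> (\<Union>(p, q)\<in>\<Q>. {p<..q})" by (rule AE_not_in)
  then have "AE s in \<nu>. ennreal (e s) * indicator {0..} s = 0"
  proof eventually_elim
    case (elim s)
    have "z s = 0"
    proof (rule ccontr)
      assume "z s \<noteq> 0"
      have "isCont z s" using cz by (simp add: continuous_on_eq_continuous_at)
      then obtain d where d: "d > 0" "\<And>r. dist s r < d \<Longrightarrow> z r \<noteq> 0"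
        using continuous_at_avoid[of s z 0] \<open>z s \<noteq> 0\<close> by blast
      obtain p where p: "p \<in> \<rat>" "s - d < p" "p < s" using Rats_dense_in_real[of "s - d" s] d by auto
      obtain q where q: "q \<in> \<rat>" "s < q" "q < s + d" using Rats_dense_in_real[of s "s + d"] d by auto
      have "(p, q) \<in> \<Q>" using p q d(2) by (auto simp: \<Q>_def dist_real_def)
      then show False using elim p q by fastforce
    qed
    then show ?case by (auto simp: z_def indicator_def)
  qed
  then show ?thesis
    unfolding \<nu>_def V_def[abs_def] by (subst nn_integral_cong_AE[where v = "\<lambda>_. 0"]) auto
qed

section \<open>Existence of the fluid solution, and the error of the scaled paths\<close>

context fluid_data
begin

lemma stability_const_pos: "stability_const T > 0"
proof -
  have "(\<Sum>i\<in>UNIV. 1 / lam $ i) \<ge> 0" using less_imp_le[OF lam_pos] by (intro sum_nonneg) simp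
  then show ?thesis by (simp add: stability_const_def)
qed

text \<open>Two members of the sequence have small errors, so stability makes the sequence uniformly
  Cauchy on compact intervals. The equations pass to the limit by dominated convergence with bound
  1. Complementarity passes through the hypothesis on zero-free intervals, which is stable under
  uniform convergence.\<close>

lemma fluid_limit:
  fixes en fn :: "nat \<Rightarrow> real \<Rightarrow> real^'r^'r" and un :: "nat \<Rightarrow> real \<Rightarrow> real^'r"
  assumes pert: "\<And>T \<epsilon>. T \<ge> 0 \<Longrightarrow> \<epsilon> > 0 \<Longrightarrow> \<forall>\<^sub>F n in sequentially. perturbed_fluid T \<epsilon> e0 f0 (en n) (fn n) (un n)"
    and int: "\<And>n T i j. (\<lambda>s. en n s $ i $ j) integrable_on {0..T}" "\<And>n T i j. (\<lambda>s. fn n s $ i $ j) integrable_on {0..T}"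
    and states: "\<And>n t. t \<ge> 0 \<Longrightarrow> (en n t, fn n t) \<in> fluid_states"
    and lip: "\<And>n s t i. 0 \<le> s \<Longrightarrow> s \<le> t \<Longrightarrow> \<bar>un n t $ i - un n s $ i\<bar> \<le> t - s"
    and mono: "\<And>n s t i. 0 \<le> s \<Longrightarrow> s \<le> t \<Longrightarrow> un n s $ i \<le> un n t $ i"
    and u0: "\<And>n i. un n 0 $ i = 0"
    and flat: "\<And>n i a b. 0 \<le> a \<Longrightarrow> a \<le> b \<Longrightarrow> (\<And>s. s \<in> {a..b} \<Longrightarrow> en n s $ i $ i \<noteq> 0) \<Longrightarrow> un n b $ i = un n a $ i"
  obtains e f u where "fluid_solution lam \<mu> P Q e0 f0 e f u"
proof -
  have unif: "\<exists>n0. \<forall>m\<ge>n0. \<forall>n\<ge>n0. \<forall>t\<in>{0..T}. \<forall>i j. \<bar>en m t $ i $ j - en n t $ i $ j\<bar> < \<epsilon> \<and>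
      \<bar>fn m t $ i $ j - fn n t $ i $ j\<bar> < \<epsilon> \<and> \<bar>un m t $ i - un n t $ i\<bar> < \<epsilon>"
    if "T \<ge> 0" "\<epsilon> > 0" for T \<epsilon>
  proof -
    \<comment> \<open>The 4 makes the distance of two members at most \<epsilon> / 2, hence strictly
      below \<epsilon>.\<close>
    define \<delta> where "\<delta> = \<epsilon> / (4 * stability_const T)"
    have \<delta>: "\<delta> > 0" "stability_const T * (\<delta> + \<delta>) < \<epsilon>"
      using stability_const_pos[of T] \<open>\<epsilon> > 0\<close> by (auto simp: \<delta>_def field_simps)
    obtain n0 where n0: "\<And>n. n \<ge> n0 \<Longrightarrow> perturbed_fluid T \<delta> e0 f0 (en n) (fn n) (un n)"
      using pert[OF \<open>T \<ge> 0\<close> \<delta>(1)] by (auto simp: eventually_sequentially)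
    show ?thesis
      using perturbed_fluid_stability[OF n0 n0] \<delta>(2) by (intro exI[of _ n0]) (meson le_less_trans)
  qed
  \<comment> \<open>At negative times \<open>lim\<close> need not be an actual limit; everything
    below concerns nonnegative times.\<close>
  define e where "e t = (\<chi> i j. lim (\<lambda>n. en n t $ i $ j))" for t
  define f where "f t = (\<chi> i j. lim (\<lambda>n. fn n t $ i $ j))" for t
  define u where "u t = (\<chi> i. lim (\<lambda>n. un n t $ i))" for t
  have conv: "convergent x" if "\<And>\<epsilon>. \<epsilon> > 0 \<Longrightarrow> \<exists>n0. \<forall>m\<ge>n0. \<forall>n\<ge>n0. \<bar>x m - x n\<bar> < \<epsilon>" for x :: "nat \<Rightarrow> real"
    using that by (intro Cauchy_convergent) (auto simp: Cauchy_def dist_real_def)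
  have lim_e: "(\<lambda>n. en n t $ i $ j) \<longlonglongrightarrow> e t $ i $ j" and lim_f: "(\<lambda>n. fn n t $ i $ j) \<longlonglongrightarrow> f t $ i $ j"
    and lim_u: "(\<lambda>n. un n t $ i) \<longlonglongrightarrow> u t $ i" if "t \<ge> 0" for t i j
  proof -
    have "convergent (\<lambda>n. en n t $ i $ j)" "convergent (\<lambda>n. fn n t $ i $ j)" "convergent (\<lambda>n. un n t $ i)"
      using unif[OF that] that by (auto intro!: conv) (meson atLeastAtMost_iff order_refl)+
    then show "(\<lambda>n. en n t $ i $ j) \<longlonglongrightarrow> e t $ i $ j" "(\<lambda>n. fn n t $ i $ j) \<longlonglongrightarrow> f t $ i $ j"
      "(\<lambda>n. un n t $ i) \<longlonglongrightarrow> u t $ i"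
      by (simp_all add: e_def f_def u_def convergent_LIMSEQ_iff)
  qed
  have bounds_n: "en n t $ i $ j \<in> {0..1}" "fn n t $ i $ j \<in> {0..1}" if "t \<ge> 0" for n t i j
    using states[OF that, of n] by (simp_all add: fluid_states_def)
  have bounds: "e t $ i $ j \<in> {0..1}" "f t $ i $ j \<in> {0..1}" if "t \<ge> 0" for t i j
    using closed_sequentially[OF closed_atLeastAtMost _ lim_e[OF that, of i j], of 0 1]
      closed_sequentially[OF closed_atLeastAtMost _ lim_f[OF that, of i j], of 0 1] bounds_n[OF that] by auto
  have states_lim: "(e t, f t) \<in> fluid_states" if t: "t \<ge> 0" for t
  proof -
    have "(\<lambda>n. \<Sum>i\<in>UNIV. \<Sum>j\<in>UNIV. en n t $ i $ j + fn n t $ i $ j) \<longlonglongrightarrow> (\<Sum>i\<in>UNIV. \<Sum>j\<in>UNIV. e t $ i $ j + f t $ i $ j)"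
      by (intro tendsto_sum tendsto_add lim_e lim_f t)
    moreover have "(\<Sum>i\<in>UNIV. \<Sum>j\<in>UNIV. en n t $ i $ j + fn n t $ i $ j) = 1" for n
      using states[OF t, of n] by (simp add: fluid_states_def)
    ultimately have "(\<Sum>i\<in>UNIV. \<Sum>j\<in>UNIV. e t $ i $ j + f t $ i $ j) = 1"
      by (simp add: LIMSEQ_const_iff)
    then show ?thesis using bounds[OF t] by (simp add: fluid_states_def)
  qed
  have int_lim: "x integrable_on {0..t}" "(\<lambda>n. integral {0..t} (y n)) \<longlonglongrightarrow> integral {0..t} x"
    if y: "\<And>n. y n integrable_on {0..t}" "\<And>n s. s \<ge> 0 \<Longrightarrow> y n s \<in> {0..1}" "\<And>s. s \<ge> 0 \<Longrightarrow> (\<lambda>n. y n s) \<longlonglongrightarrow> x s"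
    for x :: "real \<Rightarrow> real" and y t
  proof -
    have "norm (y n s) \<le> 1" if "s \<in> {0..t}" for n s using y(2)[of s n] that by auto
    then show "x integrable_on {0..t}" "(\<lambda>n. integral {0..t} (y n)) \<longlonglongrightarrow> integral {0..t} x"
      using dominated_convergence[of y "{0..t}" "\<lambda>_. 1" x] y(1,3) by auto
  qed
  have int_e: "(\<lambda>s. e s $ i $ j) integrable_on {0..t}"
      "(\<lambda>n. integral {0..t} (\<lambda>s. en n s $ i $ j)) \<longlonglongrightarrow> integral {0..t} (\<lambda>s. e s $ i $ j)" for t i j
    by (rule int_lim[of "\<lambda>n s. en n s $ i $ j"]; fact int bounds_n lim_e)+
  have int_f: "(\<lambda>s. f s $ i $ j) integrable_on {0..t}"
      "(\<lambda>n. integral {0..t} (\<lambda>s. fn n s $ i $ j)) \<longlonglongrightarrow> integral {0..t} (\<lambda>s. f s $ i $ j)" for t i j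
    by (rule int_lim[of "\<lambda>n s. fn n s $ i $ j"]; fact int bounds_n lim_f)+
  have eq_of_close: "x = y"
    if "xn \<longlonglongrightarrow> x" "yn \<longlonglongrightarrow> y" "\<And>\<epsilon>. \<epsilon> > 0 \<Longrightarrow> \<forall>\<^sub>F n in sequentially. \<bar>xn n - yn n\<bar> \<le> \<epsilon>"
    for x y :: real and xn yn :: "nat \<Rightarrow> real"
  proof -
    have "\<bar>x - y\<bar> \<le> 0 + \<epsilon>" if "\<epsilon> > 0" for \<epsilon>
      using tendsto_upperbound[OF tendsto_rabs[OF tendsto_diff[OF \<open>xn \<longlonglongrightarrow> x\<close> \<open>yn \<longlonglongrightarrow> y\<close>]], of \<epsilon>]
        \<open>\<And>\<epsilon>. \<epsilon> > 0 \<Longrightarrow> \<forall>\<^sub>F n in sequentially. \<bar>xn n - yn n\<bar> \<le> \<epsilon>\<close>[OF that] by simp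
    then have "\<bar>x - y\<bar> \<le> 0" by (rule field_le_epsilon)
    then show ?thesis by simp
  qed
  have eq_f: "f t $ i $ j = f_drift f0 f u t i j" if t: "t \<ge> 0" for t i j
  proof (rule eq_of_close[OF lim_f[OF t]])
    show "(\<lambda>n. f_drift f0 (fn n) (un n) t i j) \<longlonglongrightarrow> f_drift f0 f u t i j"
      unfolding f_drift_def by (intro tendsto_intros int_f lim_u t)
    show "\<forall>\<^sub>F n in sequentially. \<bar>fn n t $ i $ j - f_drift f0 (fn n) (un n) t i j\<bar> \<le> \<epsilon>" if "\<epsilon> > 0" for \<epsilon>
      using pert[OF t that] by eventually_elim (rule perturbed_fluidD(5), use t in auto)
  qed
  have eq_transit: "e t $ i $ j = transit_drift e0 e f t i j" if t: "t \<ge> 0" and ij: "i \<noteq> j" for t i j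
  proof (rule eq_of_close[OF lim_e[OF t]])
    show "(\<lambda>n. transit_drift e0 (en n) (fn n) t i j) \<longlonglongrightarrow> transit_drift e0 e f t i j"
      unfolding transit_drift_def by (intro tendsto_intros int_f int_e t)
    show "\<forall>\<^sub>F n in sequentially. \<bar>en n t $ i $ j - transit_drift e0 (en n) (fn n) t i j\<bar> \<le> \<epsilon>" if "\<epsilon> > 0" for \<epsilon>
      using pert[OF t that] by eventually_elim (rule perturbed_fluidD(6), use t ij in auto)
  qed
  have eq_station: "e t $ i $ i = station_drift e0 e f u t i" if t: "t \<ge> 0" for t i
  proof (rule eq_of_close[OF lim_e[OF t]])
    show "(\<lambda>n. station_drift e0 (en n) (fn n) (un n) t i) \<longlonglongrightarrow> station_drift e0 e f u t i"
      unfolding station_drift_def by (intro tendsto_intros int_f int_e lim_u t)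
    show "\<forall>\<^sub>F n in sequentially. \<bar>en n t $ i $ i - station_drift e0 (en n) (fn n) (un n) t i\<bar> \<le> \<epsilon>" if "\<epsilon> > 0" for \<epsilon>
      using pert[OF t that] by eventually_elim (rule perturbed_fluidD(7), use t in auto)
  qed
  have u_zero: "u 0 = 0"
    using LIMSEQ_unique[OF lim_u[of 0]] u0 by (simp add: vec_eq_iff)
  have u_mono: "u s $ i \<le> u t $ i" if "0 \<le> s" "s \<le> t" for s t i
    by (rule LIMSEQ_le[OF lim_u lim_u]) (use that mono in auto)
  have u_lip: "\<bar>u t $ i - u s $ i\<bar> \<le> t - s" if "0 \<le> s" "s \<le> t" for s t i
    by (rule Lim_bounded[OF tendsto_rabs[OF tendsto_diff[OF lim_u lim_u]]]) (use that lip in auto)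
  \<comment> \<open>The Lipschitz constant 1 survives the limit, so \<open>u\<close> is continuous
    and, through the equations, so are \<open>e\<close> and \<open>f\<close>, although the
    approximating states may jump.\<close>
  have cont_u: "continuous_on {0..} (\<lambda>t. u t $ i)" for i
    by (rule continuous_on_of_lipschitz) (rule u_lip)
  have cont_int: "continuous_on {0..} (\<lambda>t. integral {0..t} (\<lambda>s. e s $ i $ j))"
    "continuous_on {0..} (\<lambda>t. integral {0..t} (\<lambda>s. f s $ i $ j))" for i j
    using bounds by (auto intro!: continuous_on_of_lipschitz indefinite_integral_lipschitz int_e int_f simp: abs_le_iff)
  have cont_f: "continuous_on {0..} (\<lambda>t. f t $ i $ j)" for i j
  proof -
    have "continuous_on {0..} (\<lambda>t. f_drift f0 f u t i j)"
      unfolding f_drift_def by (intro continuous_intros cont_int cont_u)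
    then show ?thesis by (rule continuous_on_eq) (simp add: eq_f)
  qed
  have cont_e: "continuous_on {0..} (\<lambda>t. e t $ i $ j)" for i j
  proof (cases "i = j")
    case True
    have "continuous_on {0..} (\<lambda>t. station_drift e0 e f u t i)"
      unfolding station_drift_def by (intro continuous_intros cont_int cont_u)
    then show ?thesis by (rule continuous_on_eq) (simp add: eq_station True[symmetric])
  next
    case False
    have "continuous_on {0..} (\<lambda>t. transit_drift e0 e f t i j)"
      unfolding transit_drift_def by (intro continuous_intros cont_int)
    then show ?thesis by (rule continuous_on_eq) (simp add: eq_transit False)
  qed
  have "continuous_on {0..} (\<lambda>t. (\<chi> i j. e t $ i $ j, \<chi> i j. f t $ i $ j, \<chi> i. u t $ i))"
    by (intro continuous_on_Pair continuous_on_vec_lambda cont_e cont_f cont_u)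
  then have cad: "cadlag (\<lambda>t. (e t, f t, u t))"
    by (intro continuous_on_imp_cadlag) simp
  \<comment> \<open>On a compact zero-free interval the limit has a positive minimum
    \<open>c\<close>. Uniformly close approximations have no zero there either, so their reflection
    terms are constant, and so is the limit.\<close>
  have flat_lim: "u a $ i = u b $ i" if ab: "0 \<le> a" "a \<le> b" and pos: "\<And>s. s \<in> {a..b} \<Longrightarrow> e s $ i $ i \<noteq> 0" for a b i
  proof -
    obtain s0 where s0: "s0 \<in> {a..b}" "\<And>s. s \<in> {a..b} \<Longrightarrow> e s0 $ i $ i \<le> e s $ i $ i"
      using continuous_attains_inf[of "{a..b}" "\<lambda>t. e t $ i $ i"] ab continuous_on_subset[OF cont_e, of "{a..b}"] by auto
    define c where "c = e s0 $ i $ i"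
    have c: "c > 0" using pos[OF s0(1)] bounds(1)[of s0 i i] s0(1) ab by (auto simp: c_def)
    have "\<exists>n0. \<forall>n\<ge>n0. un n a $ i = un n b $ i"
    proof -
      obtain n0 where n0: "\<And>m n t. m \<ge> n0 \<Longrightarrow> n \<ge> n0 \<Longrightarrow> t \<in> {0..b} \<Longrightarrow> \<bar>en m t $ i $ i - en n t $ i $ i\<bar> < c / 2"
        using unif[of b "c / 2"] ab c by (smt (verit) half_gt_zero)
      have "un n a $ i = un n b $ i" if "n \<ge> n0" for n
      proof -
        have "en n s $ i $ i \<noteq> 0" if s: "s \<in> {a..b}" for s
        proof -
          \<comment> \<open>Letting the other index of the Cauchy estimate tend to infinity; the
            strict inequality weakens to one that still leaves \<open>en n s $ i $ i\<close> at
            least \<open>c / 2\<close>.\<close>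
          have "\<bar>en n s $ i $ i - e s $ i $ i\<bar> \<le> c / 2"
          proof (rule Lim_bounded)
            show "(\<lambda>m. \<bar>en n s $ i $ i - en m s $ i $ i\<bar>) \<longlonglongrightarrow> \<bar>en n s $ i $ i - e s $ i $ i\<bar>"
              using s ab by (intro tendsto_intros lim_e) auto
            show "\<forall>m\<ge>n0. \<bar>en n s $ i $ i - en m s $ i $ i\<bar> \<le> c / 2"
              using n0[OF \<open>n \<ge> n0\<close>, of _ s] s ab by (auto intro: less_imp_le)
          qed
          then show ?thesis using s0(2)[OF s] c unfolding c_def by auto
        qed
        then show ?thesis using flat[OF ab] by metis
      qed
      then show ?thesis by blast
    qed
    then have "eventually (\<lambda>n. un n a $ i = un n b $ i) sequentially"
      by (simp add: eventually_sequentially)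
    then have "(\<lambda>n. un n b $ i) \<longlonglongrightarrow> u a $ i"
      using lim_u[OF ab(1)] by (rule Lim_transform_eventually[rotated])
    then show ?thesis using lim_u[of b] ab by (intro LIMSEQ_unique) auto
  qed
  have compl: "(\<integral>\<^sup>+s\<in>{0..}. ennreal (e s $ i $ i) \<partial>interval_measure (\<lambda>s. u (max 0 s) $ i)) = 0" for i
  proof (rule stieltjes_null_of_flat[where v = "\<lambda>t. u t $ i" and e = "\<lambda>t. e t $ i $ i"])
    show "mono_on {0..} (\<lambda>t. u t $ i)" by (auto intro!: mono_onI u_mono)
    show "e s $ i $ i \<ge> 0" if "s \<ge> 0" for s using bounds(1)[OF that, of i i] by simp
  qed (rule cont_e cont_u flat_lim; assumption)+
  \<comment> \<open>The initial values are read off from the equations at time 0, where the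
    integrals and \<open>u\<close> vanish.\<close>
  have f_zero: "f 0 = f0"
    by (simp add: vec_eq_iff eq_f f_drift_def u_zero)
  have e_zero: "e 0 $ i $ j = e0 $ i $ j" for i j
    by (cases "i = j") (simp_all add: eq_station eq_transit transit_drift_def station_drift_def u_zero)
  have "fluid_solution lam \<mu> P Q e0 f0 e f u"
    unfolding fluid_solution_def
  proof (intro conjI allI impI)
    show "e 0 = e0" using e_zero by (simp add: vec_eq_iff)
    show "0 \<le> u t $ i" if "t \<ge> 0" for t i using u_mono[of 0 t i] that u_zero by simp
    show "mono_on {0..} (\<lambda>t. u t $ i)" for i by (auto intro!: mono_onI u_mono)
    fix t :: real and i j assume t: "0 \<le> t"
    show "f t $ i $ j = f 0 $ i $ j + lam $ i * P $ i $ j * (t - u t $ i) - \<mu> $ i $ j * integral {0..t} (\<lambda>s. f s $ i $ j)"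
      using eq_f[OF t, of i j] by (simp add: f_drift_def f_zero)
    show "e t $ i $ i = e 0 $ i $ i - lam $ i * (t - u t $ i)
        + (\<Sum>j\<in>UNIV - {i}. \<mu> $ j $ i * integral {0..t} (\<lambda>s. e s $ j $ i))
        + Q $ i $ i * (\<Sum>j\<in>UNIV. \<mu> $ j $ i * integral {0..t} (\<lambda>s. f s $ j $ i))"
      using eq_station[OF t, of i] by (simp add: station_drift_def e_zero)
    show "e t $ i $ j = e 0 $ i $ j - \<mu> $ i $ j * integral {0..t} (\<lambda>s. e s $ i $ j)
        + Q $ i $ j * (\<Sum>k\<in>UNIV. \<mu> $ k $ i * integral {0..t} (\<lambda>s. f s $ k $ i))" if "i \<noteq> j"
      using eq_transit[OF t that] by (simp add: transit_drift_def e_zero)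
  qed (fact cad states_lim f_zero u_zero compl)+
  then show thesis by (rule that)
qed

text \<open>There are finitely many primitives and entries, so a single threshold for
  \<open>N\<close> makes all clock, routing and initial errors at most \<delta>
  simultaneously.\<close>

lemma eventually_perturbed_fluid:
  fixes SE SF :: "'r \<Rightarrow> 'r \<Rightarrow> real \<Rightarrow> nat"
    and \<phi> :: "'r \<Rightarrow> nat \<Rightarrow> 'r" and \<psi> :: "'r \<Rightarrow> 'r \<Rightarrow> nat \<Rightarrow> 'r"
    and E0 F0 :: "nat \<Rightarrow> real^'r^'r" and E F :: "nat \<Rightarrow> real \<Rightarrow> real^'r^'r"
  assumes SE: "\<And>i j. sublinear_on {0..} (\<lambda>s. s) (\<lambda>s. real (SE i j s) - s)"
    and SF: "\<And>i j. sublinear_on {0..} (\<lambda>s. s) (\<lambda>s. real (SF i j s) - s)"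
    and \<phi>: "\<And>i j. sublinear_on UNIV real (\<lambda>n. real (routed (\<phi> i) j n) - P $ i $ j * real n)"
    and \<psi>: "\<And>k i j. sublinear_on UNIV real (\<lambda>n. real (routed (\<psi> k i) j n) - Q $ i $ j * real n)"
    and paths: "\<And>N. N \<ge> 1 \<Longrightarrow> network_realisation lam \<mu> P Q N SE SF \<phi> \<psi> (E0 N) (F0 N) (E N) (F N)"
    and E0: "\<And>i j. (\<lambda>N. E0 N $ i $ j / real N) \<longlonglongrightarrow> e0 $ i $ j"
    and F0: "\<And>i j. (\<lambda>N. F0 N $ i $ j / real N) \<longlonglongrightarrow> f0 $ i $ j"
    and T: "T \<ge> 0" and \<epsilon>: "\<epsilon> > 0"
  shows "\<forall>\<^sub>F N in sequentially. perturbed_fluid T \<epsilon> e0 f0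
    (\<lambda>t. (1 / real N) *\<^sub>R E N t) (\<lambda>t. (1 / real N) *\<^sub>R F N t) (idle_time (E N))"
proof -
  define \<delta> where "\<delta> = \<epsilon> / (3 + 2 * real CARD('r))"
  have \<delta>: "\<delta> > 0" "(3 + 2 * real CARD('r)) * \<delta> = \<epsilon>"
    using \<epsilon> by (auto simp: \<delta>_def field_simps add_pos_nonneg)
  \<comment> \<open>Dominates \<open>T * lam $ i\<close> and \<open>T * \<mu> $ i $ j\<close> for
    all indices, hence every clock reading up to time \<open>T\<close> after division by
    \<open>N\<close>.\<close>
  define K where "K = T * ((\<Sum>i\<in>UNIV. lam $ i) + \<mu>_total)"
  have lam_sum: "lam $ i \<le> (\<Sum>i\<in>UNIV. lam $ i)" for i
    using less_imp_le[OF lam_pos] by (intro member_le_sum) auto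
  have lam_sum0: "(\<Sum>i\<in>UNIV. lam $ i) \<ge> 0" using less_imp_le[OF lam_pos] by (intro sum_nonneg) auto
  have K: "T * lam $ i \<le> K" "T * \<mu> $ i $ j \<le> K" for i j
    unfolding K_def using lam_sum[of i] lam_sum0 \<mu>_total_pos \<mu>_le_\<mu>_total[of i j] T
    by (auto intro!: mult_left_mono)
  have K0: "K \<ge> 0" unfolding K_def using lam_sum0 \<mu>_total_pos T by simp
  have init: "\<forall>\<^sub>F N in sequentially. \<bar>x N - l\<bar> \<le> \<delta>" if "x \<longlonglongrightarrow> l" for x :: "nat \<Rightarrow> real" and l
    using tendstoD[OF that \<delta>(1)] by eventually_elim (simp add: dist_real_def)
  note ev = sublinear_on_eventually_le[OF _ K0 \<delta>(1)]
  have "\<forall>\<^sub>F N in sequentially. \<forall>i j. \<forall>s\<in>{0..real N * K}. \<bar>real (SE i j s) - s\<bar> \<le> real N * \<delta>"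
    by (intro eventually_all_finite ev SE)
  moreover have "\<forall>\<^sub>F N in sequentially. \<forall>i j. \<forall>s\<in>{0..real N * K}. \<bar>real (SF i j s) - s\<bar> \<le> real N * \<delta>"
    by (intro eventually_all_finite ev SF)
  moreover have "\<forall>\<^sub>F N in sequentially. \<forall>i j. \<forall>s\<in>{0..real N * K}. \<bar>real (routed (\<phi> i) j (SE i i s)) - P $ i $ j * s\<bar> \<le> real N * \<delta>"
    by (intro eventually_all_finite ev sublinear_of_routed SE \<phi>)
  moreover have "\<forall>\<^sub>F N in sequentially. \<forall>k i j. \<forall>s\<in>{0..real N * K}. \<bar>real (routed (\<psi> k i) j (SF k i s)) - Q $ i $ j * s\<bar> \<le> real N * \<delta>"
    by (intro eventually_all_finite ev sublinear_of_routed SF \<psi>)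
  moreover have "\<forall>\<^sub>F N in sequentially. \<forall>i j. \<bar>E0 N $ i $ j / real N - e0 $ i $ j\<bar> \<le> \<delta>"
    by (intro eventually_all_finite init E0)
  moreover have "\<forall>\<^sub>F N in sequentially. \<forall>i j. \<bar>F0 N $ i $ j / real N - f0 $ i $ j\<bar> \<le> \<delta>"
    by (intro eventually_all_finite init F0)
  moreover have "\<forall>\<^sub>F N in sequentially. N \<ge> (1::nat)" by (rule eventually_ge_at_top)
  ultimately show ?thesis
  proof eventually_elim
    case (elim N)
    interpret network_realisation lam \<mu> P Q N SE SF \<phi> \<psi> "E0 N" "F0 N" "E N" "F N"
      by (rule paths) (rule elim)
    have "perturbed_fluid T ((3 + 2 * real CARD('r)) * \<delta>) e0 f0 e f (idle_time (E N))"
      by (rule scaled_perturbed_fluid[OF T less_imp_le[OF \<delta>(1)] K]) (use elim in blast)+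
    then show ?case by (simp add: \<delta>(2) e_def[abs_def] f_def[abs_def])
  qed
qed

end

text \<open>The initial states are deterministic, so their laws are point masses. Testing with the
  distance to \<open>l\<close>, truncated at 1 to be bounded, recovers ordinary convergence.\<close>

lemma weakly_converges_return_imp_tendsto:
  fixes x :: "nat \<Rightarrow> 'a::metric_space"
  assumes "weakly_converges (\<lambda>n. return borel (x n)) (return borel l)"
  shows "x \<longlonglongrightarrow> l"
proof -
  define g where "g y = min 1 (dist y l)" for y
  have cont: "continuous_on UNIV g"
    unfolding g_def by (intro continuous_intros)
  then have meas: "g \<in> borel_measurable borel" by (rule borel_measurable_continuous_onI)
  have "bounded (range g)" by (rule boundedI[of _ 1]) (auto simp: g_def)
  with cont assms have "(\<lambda>n. \<integral>y. g y \<partial>return borel (x n)) \<longlonglongrightarrow> (\<integral>y. g y \<partial>return borel l)"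
    by (simp add: weakly_converges_def)
  then have "(\<lambda>n. g (x n)) \<longlonglongrightarrow> g l"
    using meas by (simp add: integral_return)
  then have lim: "(\<lambda>n. min 1 (dist (x n) l)) \<longlonglongrightarrow> 0" by (simp add: g_def)
  show ?thesis
  proof (rule tendstoI)
    fix \<epsilon> :: real assume "\<epsilon> > 0"
    then have "eventually (\<lambda>n. dist (min 1 (dist (x n) l)) 0 < min 1 \<epsilon>) sequentially"
      by (intro tendstoD[OF lim]) auto
    then show "eventually (\<lambda>n. dist (x n) l < \<epsilon>) sequentially"
      by eventually_elim (auto simp: min_def split: if_splits)
  qed
qed

text \<open>The coordinatewise bound also provides the boundedness without which a real supremum has
  no meaning. The lower bound 0 is what turns smallness into convergence to 0.\<close>

lemma sup_norm_upto_bounds: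
  fixes x :: "real \<Rightarrow> 'a::euclidean_space"
  assumes "T \<ge> 0" and le: "\<And>t b. t \<in> {0..T} \<Longrightarrow> b \<in> Basis \<Longrightarrow> \<bar>x t \<bullet> b\<bar> \<le> \<epsilon>"
  shows "0 \<le> sup_norm_upto T x" "sup_norm_upto T x \<le> \<epsilon>"
proof -
  have up: "(SUP t\<in>{0..T}. \<bar>x t \<bullet> b\<bar>) \<le> \<epsilon>" if "b \<in> Basis" for b
    using assms that by (intro cSUP_least) auto
  have lo: "0 \<le> (SUP t\<in>{0..T}. \<bar>x t \<bullet> b\<bar>)" if "b \<in> Basis" for b
    using assms that by (intro cSUP_upper2[of _ _ 0]) (auto intro!: bdd_aboveI2[where M = \<epsilon>])
  obtain b :: 'a where b: "b \<in> Basis" using nonempty_Basis by blast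
  show "sup_norm_upto T x \<le> \<epsilon>"
    unfolding sup_norm_upto_def using up by (subst Max_le_iff) auto
  show "0 \<le> sup_norm_upto T x"
    unfolding sup_norm_upto_def using lo[OF b] b by (subst Max_ge_iff) auto
qed

lemma abs_inner_Basis_le:
  fixes x y :: "real^'r::finite^'r" and z :: "real^'r"
  assumes "\<And>i j. \<bar>x $ i $ j\<bar> \<le> \<epsilon>" "\<And>i j. \<bar>y $ i $ j\<bar> \<le> \<epsilon>" "\<And>i. \<bar>z $ i\<bar> \<le> \<epsilon>" "b \<in> Basis"
  shows "\<bar>(x, y, z) \<bullet> b\<bar> \<le> \<epsilon>"
  using assms by (auto simp: Basis_prod_def Basis_vec_def inner_axis)

theorem theorem3:
  fixes lam :: "real^'r::finite" and \<mu> P Q :: "real^'r^'r"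
    and M :: "'w measure"
    and SE SF :: "'r \<Rightarrow> 'r \<Rightarrow> real \<Rightarrow> 'w \<Rightarrow> nat"
    and \<phi> :: "'r \<Rightarrow> nat \<Rightarrow> 'w \<Rightarrow> 'r" and \<psi> :: "'r \<Rightarrow> 'r \<Rightarrow> nat \<Rightarrow> 'w \<Rightarrow> 'r"
    and E0 F0 :: "nat \<Rightarrow> real^'r^'r" and e0 f0 :: "real^'r^'r"
    and E F :: "nat \<Rightarrow> 'w \<Rightarrow> real \<Rightarrow> real^'r^'r"
  assumes "\<And>i. lam $ i > 0" and "\<And>i j. \<mu> $ i $ j > 0"
    and "row_stochastic P" and "row_stochastic Q"
    and "network_primitives M P Q SE SF \<phi> \<psi>"
    and "\<And>N. N \<ge> 1 \<Longrightarrow> initial_state N (E0 N) (F0 N)"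
    and "\<And>N. N \<ge> 1 \<Longrightarrow> AE \<omega> in M.
           network_path lam \<mu> N (\<lambda>i j t. SE i j t \<omega>) (\<lambda>i j t. SF i j t \<omega>)
             (\<lambda>i m. \<phi> i m \<omega>) (\<lambda>i j m. \<psi> i j m \<omega>) (E0 N) (F0 N) (E N \<omega>) (F N \<omega>)"
    and "weakly_converges
           (\<lambda>N. return borel ((1 / real N) *\<^sub>R E0 N, (1 / real N) *\<^sub>R F0 N))
           (return borel (e0, f0))"
    and "(e0, f0) \<in> fluid_states"
  shows "\<exists>e f u. fluid_solution lam \<mu> P Q e0 f0 e f u \<and>
           (\<forall>e' f' u'. fluid_solution lam \<mu> P Q e0 f0 e' f' u' \<longrightarrow>
              (\<forall>t\<ge>0. e' t = e t \<and> f' t = f t \<and> u' t = u t)) \<and>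
           (\<forall>T\<ge>0. AE \<omega> in M.
              (\<lambda>N. sup_norm_upto T
                 (\<lambda>t. ((1 / real N) *\<^sub>R E N \<omega> t, (1 / real N) *\<^sub>R F N \<omega> t, idle_time (E N \<omega>) t)
                       - (e t, f t, u t))) \<longlonglongrightarrow> 0)"
proof -
  interpret network_primitives M P Q SE SF \<phi> \<psi> by fact
  interpret fluid_data lam \<mu> P Q by unfold_locales fact+
  define scaled where "scaled X N t = (1 / real N) *\<^sub>R X N t" for X :: "nat \<Rightarrow> real \<Rightarrow> real^'r^'r" and N t
  have lim: "(\<lambda>N. ((1 / real N) *\<^sub>R E0 N, (1 / real N) *\<^sub>R F0 N)) \<longlonglongrightarrow> (e0, f0)"
    by (rule weakly_converges_return_imp_tendsto) fact
  have init: "(\<lambda>N. E0 N $ i $ j / real N) \<longlonglongrightarrow> e0 $ i $ j" "(\<lambda>N. F0 N $ i $ j / real N) \<longlonglongrightarrow> f0 $ i $ j" for i j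
    using tendsto_vec_nth[OF tendsto_vec_nth[OF tendsto_fst[OF lim], of i], of j]
      tendsto_vec_nth[OF tendsto_vec_nth[OF tendsto_snd[OF lim], of i], of j] by simp_all
  define real_at where "real_at \<omega> N \<longleftrightarrow> network_realisation lam \<mu> P Q N (\<lambda>i j t. SE i j t \<omega>) (\<lambda>i j t. SF i j t \<omega>)
      (\<lambda>i m. \<phi> i m \<omega>) (\<lambda>i j m. \<psi> i j m \<omega>) (E0 N) (F0 N) (E N \<omega>) (F N \<omega>)" for \<omega> N
  \<comment> \<open>Each \<open>N\<close> has its own null set; there are countably many of them,
    and the guard excludes the degenerate scaling \<open>N = 0\<close>.\<close>
  have "AE \<omega> in M. N \<ge> 1 \<longrightarrow> real_at \<omega> N" for N
  proof (cases "N \<ge> 1")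
    case True
    show ?thesis
      using assms(7)[OF True] unfolding real_at_def
      by eventually_elim
        (use True assms(6)[OF True] fluid_data_axioms in \<open>simp add: network_realisation_def network_realisation_axioms_def\<close>)
  qed simp
  then have realisation: "AE \<omega> in M. \<forall>N\<ge>1. real_at \<omega> N"
    by (simp add: AE_all_countable)
  have "AE \<omega> in M. \<forall>i j. sublinear_on {0..} (\<lambda>s. s) (\<lambda>s. real (SE i j s \<omega>) - s)"
    by (simp add: AE_all_countable unit_poisson_process_sublinear SE_poisson)
  moreover have "AE \<omega> in M. \<forall>i j. sublinear_on {0..} (\<lambda>s. s) (\<lambda>s. real (SF i j s \<omega>) - s)"
    by (simp add: AE_all_countable unit_poisson_process_sublinear SF_poisson)
  moreover have "AE \<omega> in M. \<forall>i j. sublinear_on UNIV real (\<lambda>n. real (routed (\<lambda>m. \<phi> i m \<omega>) j n) - P $ i $ j * real n)"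
    by (simp add: AE_all_countable iid_sequence_sublinear[OF \<phi>_iid])
  moreover have "AE \<omega> in M. \<forall>k i j. sublinear_on UNIV real (\<lambda>n. real (routed (\<lambda>m. \<psi> k i m \<omega>) j n) - Q $ i $ j * real n)"
    by (simp add: AE_all_countable iid_sequence_sublinear[OF \<psi>_iid])
  \<comment> \<open>One event of full measure that serves all \<open>T\<close> and \<epsilon>; from
    here on the argument is deterministic.\<close>
  ultimately have good: "AE \<omega> in M. (\<forall>N\<ge>1. real_at \<omega> N) \<and> (\<forall>T\<ge>0. \<forall>\<epsilon>>0. \<forall>\<^sub>F N in sequentially.
      perturbed_fluid T \<epsilon> e0 f0 (scaled (\<lambda>N. E N \<omega>) N) (scaled (\<lambda>N. F N \<omega>) N) (idle_time (E N \<omega>)))"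
    using realisation
  proof eventually_elim
    case (elim \<omega>)
    have "\<forall>\<^sub>F N in sequentially.
      perturbed_fluid T \<epsilon> e0 f0 (scaled (\<lambda>N. E N \<omega>) N) (scaled (\<lambda>N. F N \<omega>) N) (idle_time (E N \<omega>))"
      if "T \<ge> 0" "\<epsilon> > 0" for T \<epsilon>
      unfolding scaled_def[abs_def]
      by (rule eventually_perturbed_fluid[where SE = "\<lambda>i j t. SE i j t \<omega>" and SF = "\<lambda>i j t. SF i j t \<omega>"
            and \<phi> = "\<lambda>i m. \<phi> i m \<omega>" and \<psi> = "\<lambda>i j m. \<psi> i j m \<omega>", OF _ _ _ _ _ init that])
         (use elim in \<open>simp_all add: real_at_def\<close>)
    then show ?case using elim by blast
  qed
  \<comment> \<open>An event of full measure in a probability space is nonempty; one point of it is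
    enough to produce the solution.\<close>
  then obtain \<omega>\<^sub>0 where \<omega>\<^sub>0: "\<And>N. N \<ge> 1 \<Longrightarrow> real_at \<omega>\<^sub>0 N"
    "\<And>T \<epsilon>. T \<ge> 0 \<Longrightarrow> \<epsilon> > 0 \<Longrightarrow> \<forall>\<^sub>F N in sequentially.
      perturbed_fluid T \<epsilon> e0 f0 (scaled (\<lambda>N. E N \<omega>\<^sub>0) N) (scaled (\<lambda>N. F N \<omega>\<^sub>0) N) (idle_time (E N \<omega>\<^sub>0))"
    using eventually_happens[OF good] ae_filter_bot by auto
  obtain e f u where sol: "fluid_solution lam \<mu> P Q e0 f0 e f u"
  proof (rule fluid_limit)
    fix n :: nat
    \<comment> \<open>The shift to \<open>Suc n\<close> skips \<open>N = 0\<close>, for which there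
      is no realisation, since the limit construction asks for its path properties at every
      index.\<close>
    interpret path: network_realisation lam \<mu> P Q "Suc n" "\<lambda>i j t. SE i j t \<omega>\<^sub>0" "\<lambda>i j t. SF i j t \<omega>\<^sub>0"
      "\<lambda>i m. \<phi> i m \<omega>\<^sub>0" "\<lambda>i j m. \<psi> i j m \<omega>\<^sub>0" "E0 (Suc n)" "F0 (Suc n)" "E (Suc n) \<omega>\<^sub>0" "F (Suc n) \<omega>\<^sub>0"
      using \<omega>\<^sub>0(1)[of "Suc n"] by (simp add: real_at_def)
    have [simp]: "scaled (\<lambda>N. E N \<omega>\<^sub>0) (Suc n) = path.e" "scaled (\<lambda>N. F N \<omega>\<^sub>0) (Suc n) = path.f"
      by (simp_all add: fun_eq_iff scaled_def path.e_def path.f_def)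
    show "(\<lambda>s. scaled (\<lambda>N. E N \<omega>\<^sub>0) (Suc n) s $ i $ j) integrable_on {0..T}"
      "(\<lambda>s. scaled (\<lambda>N. F N \<omega>\<^sub>0) (Suc n) s $ i $ j) integrable_on {0..T}" for T i j
      by (simp_all add: path.scaled_integrable)
    show "(scaled (\<lambda>N. E N \<omega>\<^sub>0) (Suc n) t, scaled (\<lambda>N. F N \<omega>\<^sub>0) (Suc n) t) \<in> fluid_states" if "t \<ge> 0" for t
      using path.scaled_fluid_states[OF that] by simp
    show "idle_time (E (Suc n) \<omega>\<^sub>0) 0 $ i = 0" for i by (simp add: idle_time_nth)
    fix s t :: real and i assume st: "0 \<le> s" "s \<le> t"
    show "idle_time (E (Suc n) \<omega>\<^sub>0) s $ i \<le> idle_time (E (Suc n) \<omega>\<^sub>0) t $ i"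
      "\<bar>idle_time (E (Suc n) \<omega>\<^sub>0) t $ i - idle_time (E (Suc n) \<omega>\<^sub>0) s $ i\<bar> \<le> t - s"
      by (rule path.idle_time_increment[OF st])+
    show "idle_time (E (Suc n) \<omega>\<^sub>0) t $ i = idle_time (E (Suc n) \<omega>\<^sub>0) s $ i"
      if "\<And>r. r \<in> {s..t} \<Longrightarrow> scaled (\<lambda>N. E N \<omega>\<^sub>0) (Suc n) r $ i $ i \<noteq> 0"
      using path.idle_time_increment(3)[OF st, of i] that by simp
  next
    fix T \<epsilon> :: real assume "T \<ge> 0" "\<epsilon> > 0"
    from \<omega>\<^sub>0(2)[OF this] show "\<forall>\<^sub>F n in sequentially. perturbed_fluid T \<epsilon> e0 f0
        (scaled (\<lambda>N. E N \<omega>\<^sub>0) (Suc n)) (scaled (\<lambda>N. F N \<omega>\<^sub>0) (Suc n)) (idle_time (E (Suc n) \<omega>\<^sub>0))"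
      by (rule eventually_sequentially_Suc[THEN iffD2])
  qed
  have unique: "e' t = e t \<and> f' t = f t \<and> u' t = u t"
    if sol': "fluid_solution lam \<mu> P Q e0 f0 e' f' u'" and t: "t \<ge> 0" for e' f' u' t
    using perturbed_fluid_stability[OF fluid_solution_imp_perturbed_fluid[OF sol' t] fluid_solution_imp_perturbed_fluid[OF sol t], of t] t
    by (simp add: vec_eq_iff)
  \<comment> \<open>The solution was built from the single realisation
    \<open>\<omega>\<^sub>0\<close>, but as an exact solution it can be compared with the scaled
    paths of every good realisation.\<close>
  have conv: "AE \<omega> in M. (\<lambda>N. sup_norm_upto T
      (\<lambda>t. ((1 / real N) *\<^sub>R E N \<omega> t, (1 / real N) *\<^sub>R F N \<omega> t, idle_time (E N \<omega>) t) - (e t, f t, u t))) \<longlonglongrightarrow> 0"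
    if T: "T \<ge> 0" for T
    using good
  proof eventually_elim
    case (elim \<omega>)
    show ?case
    proof (rule tendstoI)
      fix \<epsilon> :: real assume "\<epsilon> > 0"
      \<comment> \<open>The exact solution contributes error 0, so the distance is at most
        \<epsilon> / 2; the half yields the strict inequality after taking the supremum.\<close>
      define \<delta> where "\<delta> = \<epsilon> / (2 * stability_const T)"
      have \<delta>: "\<delta> > 0" "stability_const T * (\<delta> + 0) = \<epsilon> / 2"
        using stability_const_pos[of T] \<open>\<epsilon> > 0\<close> by (auto simp: \<delta>_def)
      have "\<forall>\<^sub>F N in sequentially. perturbed_fluid T \<delta> e0 f0 (scaled (\<lambda>N. E N \<omega>) N) (scaled (\<lambda>N. F N \<omega>) N) (idle_time (E N \<omega>))"
        using elim T \<delta>(1) by blast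
      then show "\<forall>\<^sub>F N in sequentially. dist (sup_norm_upto T
        (\<lambda>t. ((1 / real N) *\<^sub>R E N \<omega> t, (1 / real N) *\<^sub>R F N \<omega> t, idle_time (E N \<omega>) t) - (e t, f t, u t))) 0 < \<epsilon>"
      proof eventually_elim
        case (elim N)
        note close = perturbed_fluid_stability[OF elim fluid_solution_imp_perturbed_fluid[OF sol T], unfolded \<delta>(2) scaled_def]
        have "\<bar>(((1 / real N) *\<^sub>R E N \<omega> t, (1 / real N) *\<^sub>R F N \<omega> t, idle_time (E N \<omega>) t) - (e t, f t, u t)) \<bullet> b\<bar> \<le> \<epsilon> / 2"
          if "t \<in> {0..T}" "b \<in> Basis" for t b
          unfolding diff_Pair
          by (rule abs_inner_Basis_le) (use close[OF that(1)] that(2) in simp_all)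
        then show ?case
          using \<open>\<epsilon> > 0\<close> sup_norm_upto_bounds[OF T, of "\<lambda>t. ((1 / real N) *\<^sub>R E N \<omega> t, (1 / real N) *\<^sub>R F N \<omega> t, idle_time (E N \<omega>) t) - (e t, f t, u t)" "\<epsilon> / 2"]
          by simp
      qed
    qed
  qed
  show ?thesis using sol unique conv by blast
qed

end
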